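(* Let $\alpha$ be a quadratic irrational. Then there is a constant $\sigma(\alpha)>0$, depending only on $\alpha$, such that for all integers $M\ge 3$, \[ \frac1M\sum_{N=1}^M\left(\log P_N(\alpha)-\frac12\log M\right)^2=\sigma(\alpha)^2\log M+O\left((\log\log M)^4\right), \] with an implied constant depending only on $\alpha$.
   Context: The Sudler product is $P_N(\alpha)=\prod_{n=1}^N |2\sin(\pi n\alpha)|$. A quadratic irrational is an irrational real root of a quadratic polynomial with integer coefficients. *)

theory Defs
  imports Complex_Main "HOL-Computational_Algebra.Polynomial"
begin

definition sudler_product :: "nat \<Rightarrow> real \<Rightarrow> real" where
  "sudler_product N \<alpha> = (\<Prod>n=1..N. \<bar>2 * sin (pi * real n * \<alpha>)\<bar>)"

definition quadratic_irrational :: "real \<Rightarrow> bool" where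
  "quadratic_irrational \<alpha> \<longleftrightarrow>
     \<alpha> \<notin> \<rat> \<and> (\<exists>p :: int poly. degree p = 2 \<and> poly (map_poly real_of_int p) \<alpha> = 0)"

end

theory Submission
  imports Defs "HOL-Analysis.Analysis"
begin

text \<open>
The idea is to smooth the logarithm at scale \<open>1 / M\<close> in such a way that the mean comes out exactly, and
then to compute a variance by Fourier analysis.

Put \<open>r = 1 - 1 / M\<close>.  The Abel-summed Fourier series of \<open>ln \<bar>2 sin (\<pi> x)\<bar>\<close> is
\<open>- (\<Sum>m. r ^ m / m * cos (2 \<pi> m x)) = ln \<bar>1 - r e(x)\<bar>\<close> with \<open>e(x) = exp (2 \<pi> i x)\<close>.  It differs from
\<open>ln \<bar>2 sin (\<pi> x)\<bar>\<close> by \<open>O(1 / (M\<^sup>2 sin\<^sup>2 (\<pi> x)) + 1 / M)\<close>, and since \<open>\<alpha>\<close> is badly approximable these errors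
at \<open>x = n \<alpha>\<close>, \<open>n \<le> M\<close>, add up to \<open>O(1)\<close>.  So \<open>ln P\<^sub>N - ln M / 2 = a\<^sub>N + g\<^sub>N\<close>, where \<open>g\<close> has total
variation \<open>O(1)\<close> on \<open>N \<le> M\<close>, and
\<open>a\<^sub>N = - (\<Sum>m. r ^ m / m * sin ((2 N + 1) \<pi> m \<alpha>) / (2 sin (\<pi> m \<alpha>)))\<close>.  The term \<open>ln M / 2\<close> is the
contribution \<open>\<Sum>m. r ^ m / (2 m)\<close> of the constant \<open>1 / 2\<close> in the Dirichlet kernel.

The sums of \<open>a\<close> over intervals are \<open>O(M)\<close> (\<open>osc_sum_tail_le\<close>), so by summation by parts the
cross terms \<open>a\<^sub>N g\<^sub>N\<close> contribute only \<open>O(1)\<close> to the mean square, although \<open>a\<close> has size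
\<open>sqrt (ln M)\<close> and \<open>g\<close> has size \<open>1\<close>.  In the mean square of \<open>a\<close> the frequencies are nearly orthogonal: the diagonal gives
\<open>\<Sum>m\<le>M. 1 / (8 m\<^sup>2 sin\<^sup>2 (\<pi> m \<alpha>))\<close> up to \<open>O(1)\<close>, and the off-diagonal terms add up to \<open>O(1)\<close>
(\<open>osc_sum_second_moment\<close>).  The only property of \<open>\<alpha>\<close> used up to here is bad approximability, in
the form of bounds for weighted sums of \<open>\<bar>sin (\<pi> m \<alpha>)\<bar> powr (-p)\<close> with \<open>p = 3/2\<close> and \<open>p = 2\<close>.  The result is
\<open>sudler_variance\<close>.

It remains to see that the diagonal grows like a positive constant times \<open>ln M\<close>, up to \<open>O(1)\<close>
(\<open>diagonal_asymptotics\<close>).  Let \<open>\<beta>\<close> be the conjugate of \<open>\<alpha>\<close>, let \<open>n\<close> be the integer nearest to \<open>m \<alpha>\<close>, and put \<open>\<xi> = m \<alpha> - n\<close> and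
\<open>\<eta> = m \<beta> - n\<close>.  Up to summable errors the \<open>m\<close>-th term is a constant times \<open>1 / (\<xi> \<eta>)\<^sup>2\<close>, which
is invariant under the units of the quadratic order acting on the lattice \<open>\<int> + \<int> \<alpha>\<close>.  A unit
\<open>0 < \<kappa> < 1/2\<close> of norm one maps the lattice points with \<open>\<bar>\<xi>\<bar> < 1/2\<close>, \<open>\<bar>\<eta>\<bar> \<le> Y\<close> onto those with
\<open>\<bar>\<xi>\<bar> < \<kappa> / 2\<close>, \<open>\<bar>\<eta>\<bar> \<le> Y / \<kappa>\<close>.  Hence passing from \<open>Y\<close> to \<open>Y / \<kappa>\<close> adds precisely the points with
\<open>\<kappa> / 2 \<le> \<bar>\<xi>\<bar> < 1 / 2\<close>; their total weight converges, at rate \<open>1 / Y\<close>, to a positive constant, and logarithmic growth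
follows.

The error obtained is \<open>O(1)\<close>; it is absorbed by \<open>(ln (ln M)) ^ 4\<close>, which is bounded below by a positive
constant for \<open>M \<ge> 3\<close>.
\<close>


section \<open>Trigonometric sums and the smoothed logarithm\<close>

lemma abs_sin_minus_self_le: "\<bar>sin t - t\<bar> \<le> \<bar>t\<bar> ^ 3 / 6" for t :: real
proof -
  have "(\<Sum>m<3. sin_coeff m * t ^ m) = t"
    by (simp add: eval_nat_numeral sin_coeff_def)
  moreover have "(fact 3 :: real) = 6"
    by (simp add: eval_nat_numeral)
  ultimately show ?thesis
    using Maclaurin_sin_bound[of t 3] by (simp only: field_class.field_divide_inverse mult.commute)
qed

lemma abs_sin_ge_third:
  fixes t :: real
  assumes "\<bar>t\<bar> \<le> pi / 2"
  shows "\<bar>t\<bar> / 3 \<le> \<bar>sin t\<bar>"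
proof -
  have "t\<^sup>2 = \<bar>t\<bar>\<^sup>2" by simp
  also have "\<dots> \<le> 2\<^sup>2"
    using assms pi_less_4 by (intro power_mono) auto
  finally have "\<bar>t\<bar> * t\<^sup>2 \<le> \<bar>t\<bar> * 4"
    by (intro mult_left_mono) auto
  hence "\<bar>t\<bar> ^ 3 \<le> 4 * \<bar>t\<bar>"
    by (simp add: power3_eq_cube power2_eq_square)
  thus ?thesis
    using abs_sin_minus_self_le[of t] by linarith
qed

lemma abs_sin_pi_shift: "\<bar>sin (pi * (x - of_int k))\<bar> = \<bar>sin (pi * x)\<bar>"
proof -
  have "\<bar>cos (pi * of_int k)\<bar> = 1"
    by (simp add: cos_npi_int)
  moreover have "sin (pi * (x - of_int k)) = sin (pi * x) * cos (pi * of_int k)"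
    by (simp only: right_diff_distrib sin_diff sin_npi_int mult_zero_right diff_zero)
  ultimately show ?thesis
    by (simp only: abs_mult)
qed

lemma abs_le_abs_sin_pi:
  fixes y :: real
  assumes "\<bar>y\<bar> \<le> 1 / 2"
  shows "\<bar>y\<bar> \<le> \<bar>sin (pi * y)\<bar>"
proof -
  have "\<bar>pi * y\<bar> \<le> pi / 2"
    using assms mult_left_mono[OF assms, of pi] by (simp add: abs_mult)
  from abs_sin_ge_third[OF this] have "pi * \<bar>y\<bar> / 3 \<le> \<bar>sin (pi * y)\<bar>"
    by (simp add: abs_mult)
  moreover have "3 * \<bar>y\<bar> \<le> pi * \<bar>y\<bar>"
    by (intro mult_right_mono less_imp_le[OF pi_gt3]) auto
  ultimately show ?thesis by simp
qed

lemma inverse_sin_squared_bound: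
  fixes t :: real
  assumes "t \<noteq> 0" "\<bar>t\<bar> \<le> pi / 2"
  shows "\<bar>1 / (sin t)\<^sup>2 - 1 / t\<^sup>2\<bar> \<le> 3"
proof -
  have s: "\<bar>t\<bar> / 3 \<le> \<bar>sin t\<bar>" by (rule abs_sin_ge_third) fact
  have nz: "sin t \<noteq> 0" using s assms by auto
  have s2: "t\<^sup>2 / 9 \<le> (sin t)\<^sup>2"
    using power_mono[OF s, of 2] by (simp add: power_divide)
  have "\<bar>t - sin t\<bar> * \<bar>t + sin t\<bar> \<le> (\<bar>t\<bar> ^ 3 / 6) * (2 * \<bar>t\<bar>)"
    using abs_sin_minus_self_le[of t] abs_sin_x_le_abs_x[of t]
    by (intro mult_mono) (auto simp: abs_minus_commute)
  also have "\<dots> = t\<^sup>2 * t\<^sup>2 / 3"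
    by (simp add: power3_eq_cube power2_eq_square)
  also have "\<dots> \<le> t\<^sup>2 * (9 * (sin t)\<^sup>2) / 3"
    using s2 by (intro divide_right_mono mult_left_mono) auto
  also have "\<bar>t - sin t\<bar> * \<bar>t + sin t\<bar> = \<bar>t\<^sup>2 - (sin t)\<^sup>2\<bar>"
    unfolding abs_mult[symmetric] by (simp add: power2_eq_square algebra_simps)
  finally have *: "\<bar>t\<^sup>2 - (sin t)\<^sup>2\<bar> \<le> 3 * (t\<^sup>2 * (sin t)\<^sup>2)"
    by simp
  have "1 / (sin t)\<^sup>2 - 1 / t\<^sup>2 = (t\<^sup>2 - (sin t)\<^sup>2) / (t\<^sup>2 * (sin t)\<^sup>2)"
    using assms nz by (simp add: field_simps)
  also have "\<bar>\<dots>\<bar> = \<bar>t\<^sup>2 - (sin t)\<^sup>2\<bar> / (t\<^sup>2 * (sin t)\<^sup>2)"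
    by (simp add: abs_mult)
  also have "\<dots> \<le> 3"
    using * assms nz by (simp add: divide_le_eq)
  finally show ?thesis .
qed

text \<open>
After multiplication by \<open>2 * sin \<theta>\<close> the sums over odd multiples of \<open>\<theta>\<close> telescope, whence
bounds that are uniform in the range of summation.
\<close>
lemma abs_sum_sin_odd_le:
  fixes \<theta> :: real
  assumes "sin \<theta> \<noteq> 0" "n \<le> Suc M"
  shows "\<bar>\<Sum>N=n..M. sin ((2 * real N + 1) * \<theta>)\<bar> \<le> 1 / \<bar>sin \<theta>\<bar>"
proof -
  have "(\<Sum>N=n..M. cos (2 * real (Suc N) * \<theta>) - cos (2 * real N * \<theta>))
      = cos (2 * real (Suc M) * \<theta>) - cos (2 * real n * \<theta>)"
    using sum_Suc_diff[of n M "\<lambda>N. cos (2 * real N * \<theta>)"] assms(2) by simp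
  moreover have "cos (2 * real (Suc N) * \<theta>) - cos (2 * real N * \<theta>)
      = - 2 * sin \<theta> * sin ((2 * real N + 1) * \<theta>)" for N
  proof -
    have "2 * real (Suc N) * \<theta> = (2 * real N + 1) * \<theta> + \<theta>"
         "2 * real N * \<theta> = (2 * real N + 1) * \<theta> - \<theta>"
      by (simp_all add: algebra_simps)
    thus ?thesis by (simp only: cos_add cos_diff) simp
  qed
  ultimately have "- 2 * sin \<theta> * (\<Sum>N=n..M. sin ((2 * real N + 1) * \<theta>))
      = cos (2 * real (Suc M) * \<theta>) - cos (2 * real n * \<theta>)"
    by (simp add: sum_distrib_left)
  hence "\<bar>- 2 * sin \<theta> * (\<Sum>N=n..M. sin ((2 * real N + 1) * \<theta>))\<bar> \<le> 2"
    using abs_cos_le_one[of "2 * real (Suc M) * \<theta>"] abs_cos_le_one[of "2 * real n * \<theta>"]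
    by linarith
  thus ?thesis using assms by (simp add: abs_mult field_simps)
qed

lemma abs_sum_cos_odd_le:
  fixes \<theta> :: real
  assumes "sin \<theta> \<noteq> 0" "n \<le> Suc M"
  shows "\<bar>\<Sum>N=n..M. cos ((2 * real N + 1) * \<theta>)\<bar> \<le> 1 / \<bar>sin \<theta>\<bar>"
proof -
  have "(\<Sum>N=n..M. sin (2 * real (Suc N) * \<theta>) - sin (2 * real N * \<theta>))
      = sin (2 * real (Suc M) * \<theta>) - sin (2 * real n * \<theta>)"
    using sum_Suc_diff[of n M "\<lambda>N. sin (2 * real N * \<theta>)"] assms(2) by simp
  moreover have "sin (2 * real (Suc N) * \<theta>) - sin (2 * real N * \<theta>)
      = 2 * sin \<theta> * cos ((2 * real N + 1) * \<theta>)" for N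
  proof -
    have "2 * real (Suc N) * \<theta> = (2 * real N + 1) * \<theta> + \<theta>"
         "2 * real N * \<theta> = (2 * real N + 1) * \<theta> - \<theta>"
      by (simp_all add: algebra_simps)
    thus ?thesis by (simp only: sin_add sin_diff) simp
  qed
  ultimately have "2 * sin \<theta> * (\<Sum>N=n..M. cos ((2 * real N + 1) * \<theta>))
      = sin (2 * real (Suc M) * \<theta>) - sin (2 * real n * \<theta>)"
    by (simp add: sum_distrib_left)
  hence "\<bar>2 * sin \<theta> * (\<Sum>N=n..M. cos ((2 * real N + 1) * \<theta>))\<bar> \<le> 2"
    using abs_sin_le_one[of "2 * real (Suc M) * \<theta>"] abs_sin_le_one[of "2 * real n * \<theta>"]
    by linarith
  thus ?thesis using assms by (simp add: abs_mult field_simps)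
qed

lemma sum_cos_even:
  fixes \<theta> :: real
  assumes "sin \<theta> \<noteq> 0"
  shows "(\<Sum>n=1..N. cos (2 * real n * \<theta>)) = sin ((2 * real N + 1) * \<theta>) / (2 * sin \<theta>) - 1 / 2"
proof (induction N)
  case (Suc N)
  have "sin ((2 * real (Suc N) + 1) * \<theta>) - sin ((2 * real N + 1) * \<theta>)
      = 2 * sin \<theta> * cos (2 * real (Suc N) * \<theta>)"
  proof -
    have "(2 * real (Suc N) + 1) * \<theta> = 2 * real (Suc N) * \<theta> + \<theta>"
         "(2 * real N + 1) * \<theta> = 2 * real (Suc N) * \<theta> - \<theta>"
      by (simp_all add: algebra_simps)
    thus ?thesis by (simp only: sin_add sin_diff) simp
  qed
  thus ?case using Suc assms by (simp add: field_simps)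
qed (use assms in simp)

lemma Re_of_real_mult: "Re (of_real a * z) = a * Re z"
  by simp

text \<open>
The real part of the power series of \<open>ln (1 - z)\<close> at \<open>z = r * exp (2 * \<i> * x)\<close>, using
\<open>\<bar>1 - z\<bar>\<^sup>2 = (1 - r)\<^sup>2 + 4 * r * (sin x)\<^sup>2\<close>.
\<close>
lemma log_Abel_series:
  fixes x r :: real
  assumes "0 \<le> r" "r < 1"
  shows "(\<lambda>m. r ^ m / real m * cos (2 * real m * x)) sums
    (- ln ((1 - r)\<^sup>2 + 4 * r * (sin x)\<^sup>2) / 2)"
proof -
  define z where "z = complex_of_real r * cis (2 * x)"
  have nz: "norm (- z) < 1" using assms by (simp add: z_def norm_mult)
  have ne: "1 - z \<noteq> 0" using nz by auto
  have "(\<lambda>n. Re (- ((- (- z))^n) / of_nat n)) sums Re (ln (1 + (- z)))"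
    by (intro sums_Re Ln_series' nz)
  moreover have "Re (- ((- (- z))^n) / of_nat n) = - (r ^ n / real n * cos (2 * real n * x))" for n
  proof -
    have "z ^ n = of_real (r ^ n) * cis (real n * (2 * x))"
      by (simp only: z_def power_mult_distrib Complex.DeMoivre of_real_power)
    hence "Re (z ^ n) = r ^ n * cos (real n * (2 * x))"
      by simp
    hence "Re (z ^ n) = r ^ n * cos (2 * real n * x)"
      by (simp only: mult.left_commute mult.assoc)
    moreover have "- (z ^ n) / of_nat n = of_real (- 1 / real n) * z ^ n"
      by simp
    hence "Re (- (z ^ n) / of_nat n) = - 1 / real n * Re (z ^ n)"
      by (simp only: Re_of_real_mult)
    ultimately show ?thesis by simp
  qed
  ultimately have "(\<lambda>n. - (r ^ n / real n * cos (2 * real n * x))) sums Re (ln (1 + (- z)))"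
    by (simp only:)
  moreover have "Re (ln (1 + (- z))) = ln (norm (1 - z))"
    using ne by (simp add: Re_Ln)
  ultimately have "(\<lambda>n. - (r ^ n / real n * cos (2 * real n * x))) sums ln (norm (1 - z))"
    by (simp only:)
  from sums_minus[OF this]
  have s: "(\<lambda>n. r ^ n / real n * cos (2 * real n * x)) sums (- ln (norm (1 - z)))" by simp
  have "Re (1 - z) = 1 - r * cos (2 * x)" "Im (1 - z) = - (r * sin (2 * x))"
    by (simp_all add: z_def)
  hence "(norm (1 - z))\<^sup>2 = (1 - r * cos (2 * x))\<^sup>2 + (r * sin (2 * x))\<^sup>2"
    by (simp only: cmod_power2 power2_minus)
  also have "\<dots> = 1 - 2 * r * cos (2 * x) + r\<^sup>2 * ((sin (2*x))\<^sup>2 + (cos (2 * x))\<^sup>2)"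
    by algebra
  also have "\<dots> = (1 - r)\<^sup>2 + 4 * r * (sin x)\<^sup>2"
    unfolding sin_cos_squared_add unfolding cos_double_sin by algebra
  finally have "ln ((norm (1 - z))\<^sup>2) = ln ((1 - r)\<^sup>2 + 4 * r * (sin x)\<^sup>2)" by simp
  hence "- ln (norm (1 - z)) = - ln ((1 - r)\<^sup>2 + 4 * r * (sin x)\<^sup>2) / 2"
    using ne by (simp add: ln_realpow)
  thus ?thesis using s by (simp only:)
qed

section \<open>Elementary sums\<close>

text \<open>
Summation by parts in the form in which it is needed: a comparison of all partial sums survives
decreasing weights.
\<close>
lemma sum_antimono_weight_le:
  fixes w a b :: "nat \<Rightarrow> real"
  assumes w: "\<And>m. 1 \<le> m \<Longrightarrow> 0 \<le> w m" "\<And>m. 1 \<le> m \<Longrightarrow> w (Suc m) \<le> w m"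
    and ab: "\<And>X. (\<Sum>m=1..X. a m) \<le> (\<Sum>m=1..X. b m)"
  shows "(\<Sum>m=1..L. w m * a m) \<le> (\<Sum>m=1..L. w m * b m)"
proof -
  define D where "D = (\<lambda>X. \<Sum>m=1..X. b m - a m)"
  have D: "0 \<le> D X" for X using ab[of X] by (simp add: D_def sum_subtractf)
  have "0 \<le> w L * D L \<or> L = 0"
    using D[of L] w(1)[of L] by (cases L) auto
  moreover have "w L * D L \<le> (\<Sum>m=1..L. w m * (b m - a m))"
  proof (induction L)
    case (Suc L)
    have "w (Suc L) * D L \<le> w L * D L"
      using D[of L] w(2)[of L] by (cases L) (auto simp: D_def intro: mult_right_mono)
    thus ?case using Suc by (simp add: D_def distrib_left)
  qed (simp add: D_def)
  ultimately have "0 \<le> (\<Sum>m=1..L. w m * (b m - a m))" by auto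
  thus ?thesis by (simp add: right_diff_distrib sum_subtractf)
qed

lemma sum_int_powr_le:
  fixes p :: real
  assumes "p > 1" "finite A"
  shows "(\<Sum>k\<in>A. \<bar>real_of_int k\<bar> powr (-p)) \<le> 2 * (\<Sum>n. real n powr (-p))"
proof -
  have summ: "summable (\<lambda>n. real n powr (-p))"
    using assms(1) by (simp add: summable_real_powr_iff)
  have half: "(\<Sum>k\<in>B. \<bar>real_of_int k\<bar> powr (-p)) \<le> (\<Sum>n. real n powr (-p))"
    if B: "finite B" "inj_on (\<lambda>k. nat \<bar>k\<bar>) B" for B
  proof -
    have "(\<Sum>k\<in>B. \<bar>real_of_int k\<bar> powr (-p)) = (\<Sum>n\<in>(\<lambda>k. nat \<bar>k\<bar>) ` B. real n powr (-p))"
      by (subst sum.reindex[OF B(2)]) (simp add: o_def)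
    also have "\<dots> \<le> (\<Sum>n. real n powr (-p))"
      using B(1) by (intro sum_le_suminf summ) auto
    finally show ?thesis .
  qed
  have "(\<Sum>k\<in>A. \<bar>real_of_int k\<bar> powr (-p))
      = (\<Sum>k\<in>A \<inter> {0..}. \<bar>real_of_int k\<bar> powr (-p)) + (\<Sum>k\<in>A - {0..}. \<bar>real_of_int k\<bar> powr (-p))"
    using assms(2) by (rule sum.Int_Diff)
  also have "\<dots> \<le> (\<Sum>n. real n powr (-p)) + (\<Sum>n. real n powr (-p))"
    using assms(2) by (intro add_mono half) (auto simp: inj_on_def)
  finally show ?thesis by simp
qed

lemma square_le_sum_double: "(real X)\<^sup>2 \<le> (\<Sum>m=1..X. 2 * real m)"
proof (induction X)
  case (Suc X)
  have "(real (Suc X))\<^sup>2 = (real X)\<^sup>2 + 2 * real X + 1"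
    by (simp add: power2_eq_square algebra_simps)
  thus ?case using Suc by simp
qed simp

lemma mult_sqrt_le_sum_sqrt: "real X * sqrt (real X) \<le> (\<Sum>m=1..X. 2 * sqrt (real m))"
proof (induction X)
  case (Suc X)
  define a b where "a = sqrt (real X)" and "b = sqrt (real (Suc X))"
  have ab: "0 \<le> a" "a \<le> b" "a\<^sup>2 = real X" "b\<^sup>2 = real X + 1"
    by (simp_all add: a_def b_def)
  have "b\<^sup>2 * b - a\<^sup>2 * a = (b\<^sup>2 - a\<^sup>2) * b + a * (a * (b - a))"
    by algebra
  also have "a * (b - a) \<le> 1"
  proof -
    have "a * (b - a) \<le> (b + a) * (b - a)" using ab by (intro mult_right_mono) auto
    also have "\<dots> = 1" using ab by (simp add: algebra_simps power2_eq_square)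
    finally show ?thesis .
  qed
  hence "(b\<^sup>2 - a\<^sup>2) * b + a * (a * (b - a)) \<le> b + a * 1"
    using ab by (intro add_mono mult_left_mono) auto
  finally have "b\<^sup>2 * b - a\<^sup>2 * a \<le> 2 * b" using ab by simp
  hence "real (Suc X) * b \<le> real X * a + 2 * b" using ab by (simp add: add.commute)
  thus ?case using Suc by (simp add: a_def b_def)
qed simp

lemma sum_inverse_sqrt_le: "(\<Sum>m=1..X. 1 / sqrt (real m)) \<le> 2 * sqrt (real X)"
proof (induction X)
  case (Suc X)
  define a b where "a = sqrt (real X)" and "b = sqrt (real (Suc X))"
  have ab: "0 \<le> a" "a \<le> b" "a\<^sup>2 = real X" "b\<^sup>2 = real X + 1" "b > 0"
    by (simp_all add: a_def b_def)
  have "1 = (b + a) * (b - a)" using ab by (simp add: algebra_simps power2_eq_square)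
  also have "\<dots> \<le> (2 * b) * (b - a)" using ab by (intro mult_right_mono) auto
  finally have "1 / b \<le> 2 * (b - a)" using ab by (simp add: divide_le_eq mult_ac)
  thus ?case using Suc by (simp add: a_def b_def)
qed simp

lemma sum_power_le:
  fixes r :: real
  assumes "0 \<le> r" "r < 1"
  shows "(\<Sum>m=1..L. r ^ m) \<le> 1 / (1 - r)"
proof -
  have "(\<Sum>m=1..L. r ^ m) \<le> (\<Sum>m. r ^ m)"
    using assms by (intro sum_le_suminf summable_geometric) auto
  thus ?thesis using assms by (simp add: suminf_geometric)
qed

text \<open>
The terms with \<open>m \<le> K\<close> are at most \<open>1 / sqrt m\<close>, the others at most \<open>\<rho> ^ m / sqrt K\<close>.
\<close>
lemma sum_power_over_sqrt_le:
  fixes \<rho> :: real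
  assumes "0 \<le> \<rho>" "\<rho> < 1" "K > 0" "1 / (1 - \<rho>) \<le> 2 * real K"
  shows "(\<Sum>m=1..L. \<rho> ^ m / sqrt (real m)) \<le> 4 * sqrt (real K)"
proof -
  have "(\<Sum>m=1..L. \<rho> ^ m / sqrt (real m))
      \<le> (\<Sum>m=1..L. (if m \<le> K then 1 / sqrt (real m) else 0) + \<rho> ^ m / sqrt (real K))"
  proof (rule sum_mono)
    fix m assume "m \<in> {1..L}"
    hence m: "m \<ge> 1" by simp
    show "\<rho> ^ m / sqrt (real m) \<le> (if m \<le> K then 1 / sqrt (real m) else 0) + \<rho> ^ m / sqrt (real K)"
    proof (cases "m \<le> K")
      case True
      have "\<rho> ^ m / sqrt (real m) \<le> 1 / sqrt (real m)"
        using assms by (intro divide_right_mono power_le_one) auto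
      thus ?thesis using True assms by (simp add: add_increasing2)
    next
      case False
      thus ?thesis using m assms by (simp add: divide_left_mono)
    qed
  qed
  also have "\<dots> = (\<Sum>m=1..L. if m \<le> K then 1 / sqrt (real m) else 0)
      + (\<Sum>m=1..L. \<rho> ^ m) / sqrt (real K)"
    by (simp add: sum.distrib sum_divide_distrib)
  also have "\<dots> \<le> 2 * sqrt (real K) + 2 * real K / sqrt (real K)"
  proof (intro add_mono divide_right_mono)
    have "(\<Sum>m=1..L. if m \<le> K then 1 / sqrt (real m) else 0)
        = (\<Sum>m\<in>{1..L} \<inter> {..K}. 1 / sqrt (real m))"
      by (simp only: sum.inter_restrict finite_atLeastAtMost atMost_iff)
    also have "\<dots> \<le> (\<Sum>m=1..K. 1 / sqrt (real m))"
      by (intro sum_mono2) auto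
    also have "\<dots> \<le> 2 * sqrt (real K)" by (rule sum_inverse_sqrt_le)
    finally show "(\<Sum>m=1..L. if m \<le> K then 1 / sqrt (real m) else 0) \<le> 2 * sqrt (real K)" .
    show "(\<Sum>m=1..L. \<rho> ^ m) \<le> 2 * real K"
      using sum_power_le[OF assms(1,2), of L] assms(4) by linarith
  qed simp
  also have "2 * real K / sqrt (real K) = 2 * sqrt (real K)"
    by (metis of_nat_0_le_iff real_div_sqrt times_divide_eq_right)
  finally show ?thesis by simp
qed

lemma sum_inverse_squares_tail_nat:
  fixes x :: real
  assumes "finite G" "0 < x" "\<And>n. n \<in> G \<Longrightarrow> x < real n"
  shows "(\<Sum>n\<in>G. 1 / (real n)\<^sup>2) \<le> 2 / x"
proof -
  define k where "k = nat \<lfloor>x\<rfloor> + 1"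
  have k: "x < real k" "1 \<le> k" using assms(2) unfolding k_def by linarith+
  have mem: "k \<le> n" if "n \<in> G" for n
    using assms(3)[OF that] assms(2) unfolding k_def by linarith
  have tele: "(\<Sum>n=k..<K. 1 / (real n)\<^sup>2) \<le> 1 / (real k - 1 / 2) - 1 / (real K - 1 / 2)" if "k \<le> K" for K
    using that
  proof (induction K rule: nat_induct_at_least)
    case (Suc K)
    have K: "real K \<ge> 1" using Suc k by linarith
    have "0 < (real K - 1 / 2) * (real K + 1 / 2)" using K by (intro mult_pos_pos) auto
    moreover have "(real K - 1 / 2) * (real K + 1 / 2) \<le> (real K)\<^sup>2"
      by (simp add: algebra_simps power2_eq_square)
    ultimately have "1 / (real K)\<^sup>2 \<le> 1 / ((real K - 1 / 2) * (real K + 1 / 2))"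
      by (intro frac_le) auto
    also have "\<dots> = 1 / (real K - 1 / 2) - 1 / (real (Suc K) - 1 / 2)"
      using K by (simp add: field_simps)
    finally show ?case using Suc by simp
  qed simp
  define K where "K = k + Suc (Max (insert 0 G))"
  have "n < K" if "n \<in> G" for n
  proof -
    have "n \<le> Max (insert 0 G)" using that assms(1) by (intro Max_ge) auto
    thus ?thesis unfolding K_def by linarith
  qed
  hence "G \<subseteq> {k..<K}" using mem by auto
  hence "(\<Sum>n\<in>G. 1 / (real n)\<^sup>2) \<le> (\<Sum>n=k..<K. 1 / (real n)\<^sup>2)"
    by (intro sum_mono2) auto
  also have "\<dots> \<le> 1 / (real k - 1 / 2) - 1 / (real K - 1 / 2)"
    by (rule tele) (simp add: K_def)
  also have "\<dots> \<le> 1 / (real k - 1 / 2)" using k by (simp add: K_def)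
  also have "\<dots> \<le> 1 / (x / 2)" proof -
    have "x / 2 \<le> real k - 1 / 2" using k by linarith
    thus ?thesis using assms(2) by (intro frac_le) auto
  qed
  finally show ?thesis by simp
qed

lemma sum_inverse_squares_tail:
  fixes x :: real and F :: "int set"
  assumes "finite F" "0 < x" "\<And>m. m \<in> F \<Longrightarrow> x < \<bar>real_of_int m\<bar>"
  shows "(\<Sum>m\<in>F. 1 / (real_of_int m)\<^sup>2) \<le> 4 / x"
proof -
  have half: "(\<Sum>m\<in>B. 1 / (real_of_int m)\<^sup>2) \<le> 2 / x"
    if B: "B \<subseteq> F" "inj_on (\<lambda>k. nat \<bar>k\<bar>) B" for B
  proof -
    have "(\<Sum>m\<in>B. 1 / (real_of_int m)\<^sup>2) = (\<Sum>n\<in>(\<lambda>k. nat \<bar>k\<bar>) ` B. 1 / (real n)\<^sup>2)"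
      by (subst sum.reindex[OF B(2)]) (simp add: o_def)
    also have "\<dots> \<le> 2 / x"
      using B(1) assms finite_subset[OF B(1) assms(1)]
      by (intro sum_inverse_squares_tail_nat) auto
    finally show ?thesis .
  qed
  have "(\<Sum>m\<in>F. 1 / (real_of_int m)\<^sup>2)
      = (\<Sum>m\<in>F \<inter> {0..}. 1 / (real_of_int m)\<^sup>2) + (\<Sum>m\<in>F - {0..}. 1 / (real_of_int m)\<^sup>2)"
    using assms(1) by (rule sum.Int_Diff)
  also have "\<dots> \<le> 2 / x + 2 / x"
    by (intro add_mono half) (auto simp: inj_on_def)
  finally show ?thesis by simp
qed

text \<open>
An additive defect of size \<open>C / Y\<close> is summable along \<open>Y, \<epsilon> Y, \<epsilon>\<^sup>2 Y, ...\<close>.  The induction carries the bound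
\<open>B - C' / Y\<close>, in which \<open>C' = C \<epsilon> / (\<epsilon> - 1)\<close> is chosen so that each step exactly consumes its defect.
\<close>
lemma log_growth_of_scaling:
  fixes f :: "real \<Rightarrow> real"
  assumes e: "\<epsilon> > 1" and C: "C \<ge> 0"
    and step: "\<And>Y. 1 \<le> Y \<Longrightarrow> \<bar>f (\<epsilon> * Y) - f Y - g\<bar> \<le> C / Y"
    and bdd: "\<And>Y. 1 \<le> Y \<Longrightarrow> Y \<le> \<epsilon> \<Longrightarrow> \<bar>f Y\<bar> \<le> B0"
  shows "\<exists>B. \<forall>Y\<ge>1. \<bar>f Y - g / ln \<epsilon> * ln Y\<bar> \<le> B"
proof -
  define h where "h Y = f Y - g / ln \<epsilon> * ln Y" for Y
  define C' where "C' = C * \<epsilon> / (\<epsilon> - 1)"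
  define B where "B = B0 + \<bar>g\<bar> + C'"
  have lne: "ln \<epsilon> > 0" using e by simp
  have C': "C' \<ge> 0" "C' * \<epsilon> = C * \<epsilon> + C'" using e C by (auto simp: C'_def field_simps)
  have base: "\<bar>h Y\<bar> \<le> B - C' / Y" if Y: "1 \<le> Y" "Y \<le> \<epsilon>" for Y
  proof -
    have "\<bar>g / ln \<epsilon> * ln Y\<bar> = \<bar>g\<bar> * (ln Y / ln \<epsilon>)" using lne Y by (simp add: abs_mult)
    also have "\<dots> \<le> \<bar>g\<bar> * 1" using lne Y by (intro mult_left_mono) auto
    finally have "\<bar>h Y\<bar> \<le> B0 + \<bar>g\<bar>" using bdd[OF Y] unfolding h_def by linarith
    moreover have "C' / Y \<le> C' / 1" using C' Y by (intro divide_left_mono) auto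
    ultimately show ?thesis by (simp add: B_def)
  qed
  have main: "\<bar>h Y\<bar> \<le> B - C' / Y" if "1 \<le> Y" "Y \<le> \<epsilon> ^ Suc k" for k Y
    using that
  proof (induction k arbitrary: Y)
    case (Suc k)
    show ?case
    proof (cases "Y \<le> \<epsilon>")
      case False
      define Z where "Z = Y / \<epsilon>"
      have Z: "1 \<le> Z" "Z \<le> \<epsilon> ^ Suc k" "Y = \<epsilon> * Z"
        using False Suc.prems e by (auto simp: Z_def field_simps)
      have "h Y - h Z = f (\<epsilon> * Z) - f Z - g"
      proof -
        have "ln (\<epsilon> * Z) = ln \<epsilon> + ln Z" using Z(1) e by (intro ln_mult_pos) auto
        hence "g / ln \<epsilon> * ln (\<epsilon> * Z) = g + g / ln \<epsilon> * ln Z"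
          using lne by (simp only: distrib_left) simp
        thus ?thesis unfolding h_def Z(3) by linarith
      qed
      hence "\<bar>h Y\<bar> \<le> \<bar>h Z\<bar> + C / Z" using step[OF Z(1)] by linarith
      also have "\<dots> \<le> B - C' / Z + C / Z" using Suc.IH[OF Z(1,2)] by simp
      also have "\<dots> = B - C' / Y"
      proof -
        have "C' / Z = C' * \<epsilon> / Y" "C / Z = C * \<epsilon> / Y" by (simp_all add: Z_def)
        thus ?thesis using C'(2) by (simp add: add_divide_distrib)
      qed
      finally show ?thesis .
    qed (use base Suc.prems in simp)
  qed (use base in simp)
  show ?thesis
  proof (intro exI[of _ B] allI impI)
    fix Y :: real assume Y: "Y \<ge> 1"
    obtain k where "Y < \<epsilon> ^ k" using real_arch_pow[OF e] by blast
    also have "\<dots> \<le> \<epsilon> ^ Suc k" using e by (intro power_increasing) auto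
    finally have "\<bar>h Y\<bar> \<le> B - C' / Y" using main[of Y k] Y by simp
    also have "\<dots> \<le> B" using C' Y by simp
    finally show "\<bar>f Y - g / ln \<epsilon> * ln Y\<bar> \<le> B" by (simp add: h_def)
  qed
qed

section \<open>Badly approximable numbers\<close>

locale badly_approximable =
  fixes \<alpha> c :: real
  assumes c_pos: "0 < c"
    and approx: "\<And>m n. 0 < m \<Longrightarrow> c \<le> real m * \<bar>real m * \<alpha> - of_int n\<bar>"
begin

definition s :: "nat \<Rightarrow> real" where
  "s m = \<bar>sin (pi * real m * \<alpha>)\<bar>"

lemma dist_round_le_s: "\<bar>real m * \<alpha> - of_int (round (real m * \<alpha>))\<bar> \<le> s m"
proof -
  have "\<bar>real m * \<alpha> - of_int (round (real m * \<alpha>))\<bar> \<le> 1 / 2"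
    using of_int_round_abs_le[of "real m * \<alpha>"] by (simp add: abs_minus_commute)
  from abs_le_abs_sin_pi[OF this] show ?thesis
    by (simp only: abs_sin_pi_shift s_def mult.assoc)
qed

lemma s_lower: "0 < m \<Longrightarrow> c / real m \<le> s m"
  using order.trans[OF approx[of m "round (real m * \<alpha>)"]
    mult_left_mono[OF dist_round_le_s[of m], of "real m"]]
  by (simp add: divide_le_eq mult.commute[of "s m"])

lemma s_pos: "0 < m \<Longrightarrow> 0 < s m"
  using s_lower[of m] c_pos by (meson divide_pos_pos less_le_trans of_nat_0_less_iff)

lemma sin_nonzero: "0 < m \<Longrightarrow> sin (pi * real m * \<alpha>) \<noteq> 0"
  using s_pos[of m] by (simp add: s_def)

lemma s_le_add_sum: "s a \<le> s b + s (a + b)"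
proof -
  have "s a = \<bar>sin (pi * real (a + b) * \<alpha> - pi * real b * \<alpha>)\<bar>"
    by (simp add: s_def distrib_left distrib_right)
  also have "\<dots> \<le> \<bar>sin (pi * real (a + b) * \<alpha>)\<bar> * \<bar>cos (pi * real b * \<alpha>)\<bar>
      + \<bar>cos (pi * real (a + b) * \<alpha>)\<bar> * \<bar>sin (pi * real b * \<alpha>)\<bar>"
    unfolding sin_diff by (rule order.trans[OF abs_triangle_ineq4]) (simp add: abs_mult)
  also have "\<dots> \<le> \<bar>sin (pi * real (a + b) * \<alpha>)\<bar> * 1 + 1 * \<bar>sin (pi * real b * \<alpha>)\<bar>"
    by (intro add_mono mult_left_mono mult_right_mono) auto
  finally show ?thesis by (simp add: s_def)
qed

text \<open>
For \<open>m \<le> X\<close> the signed distances of \<open>m \<alpha>\<close> to the nearest integer are at least \<open>c / X\<close> apart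
from each other and from zero.  Cutting the line into cells of length \<open>c / X\<close>, each cell contains at most
one of them, and a point in cell number \<open>k\<close> has size at least \<open>\<bar>k\<bar> c / (2 X)\<close>; the factor \<open>2\<close> absorbs the
asymmetry of the floor function for negative \<open>k\<close>.
\<close>
lemma sum_s_powr_le:
  fixes p :: real
  assumes "p > 1"
  shows "(\<Sum>m=1..X. s m powr (-p)) \<le> 2 * (2 / c) powr p * (\<Sum>n. real n powr (-p)) * real X powr p"
proof (cases "X = 0")
  case False
  define \<xi> where "\<xi> m = real m * \<alpha> - of_int (round (real m * \<alpha>))" for m
  define \<phi> where "\<phi> m = \<lfloor>\<xi> m * real X / c\<rfloor>" for m
  have inj': False if "m < m'" "m \<in> {1..X}" "m' \<in> {1..X}" "\<phi> m = \<phi> m'" for m m'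
  proof -
    have "\<bar>\<xi> m' * real X / c - \<xi> m * real X / c\<bar> < 1"
      using that(4) unfolding \<phi>_def by linarith
    moreover have "\<xi> m' * real X / c - \<xi> m * real X / c = (\<xi> m' - \<xi> m) * (real X / c)"
      by (simp add: algebra_simps diff_divide_distrib)
    ultimately have "\<bar>\<xi> m' - \<xi> m\<bar> * (real X / c) < 1"
      using False c_pos by (simp only: abs_mult) simp
    hence "\<bar>\<xi> m' - \<xi> m\<bar> * real X < c"
      using c_pos by (simp add: field_simps)
    moreover have "real (m' - m) * \<bar>\<xi> m' - \<xi> m\<bar> \<le> real X * \<bar>\<xi> m' - \<xi> m\<bar>"
      using that by (intro mult_right_mono) auto
    moreover have "\<xi> m' - \<xi> m
        = real (m' - m) * \<alpha> - of_int (round (real m' * \<alpha>) - round (real m * \<alpha>))"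
      using that(1) by (simp add: \<xi>_def of_nat_diff algebra_simps)
    ultimately show False
      using approx[of "m' - m" "round (real m' * \<alpha>) - round (real m * \<alpha>)"] that(1)
      by (simp add: mult.commute)
  qed
  have inj: "inj_on \<phi> {1..X}"
  proof (rule inj_onI)
    fix x y assume "x \<in> {1..X}" "y \<in> {1..X}" "\<phi> x = \<phi> y"
    thus "x = y" using inj'[of x y] inj'[of y x] by (cases x y rule: linorder_cases) auto
  qed
  have lower: "\<phi> m \<noteq> 0 \<and> \<bar>real_of_int (\<phi> m)\<bar> * (c / (2 * real X)) \<le> s m"
    if m: "m \<in> {1..X}" for m
  proof -
    define x where "x = \<xi> m * real X / c"
    have "c \<le> real m * \<bar>\<xi> m\<bar>" using approx[of m] m by (simp add: \<xi>_def)
    also have "\<dots> \<le> real X * \<bar>\<xi> m\<bar>" using m by (intro mult_right_mono) auto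
    finally have x1: "1 \<le> \<bar>x\<bar>" using c_pos by (simp add: x_def abs_mult field_simps)
    have "\<phi> m = \<lfloor>x\<rfloor>" by (simp add: \<phi>_def x_def)
    hence *: "\<phi> m \<noteq> 0" "\<bar>real_of_int (\<phi> m)\<bar> \<le> 2 * \<bar>x\<bar>" using x1 by linarith+
    have "\<bar>real_of_int (\<phi> m)\<bar> * (c / (2 * real X)) \<le> (2 * \<bar>x\<bar>) * (c / (2 * real X))"
      using * c_pos by (intro mult_right_mono) auto
    also have "\<dots> = \<bar>\<xi> m\<bar>" using False c_pos by (simp add: x_def abs_mult)
    also have "\<dots> \<le> s m" using dist_round_le_s by (simp add: \<xi>_def)
    finally show ?thesis using * by simp
  qed
  have "(\<Sum>m=1..X. s m powr (-p)) \<le> (\<Sum>m=1..X. (c / (2 * real X)) powr (-p) * \<bar>real_of_int (\<phi> m)\<bar> powr (-p))"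
  proof (rule sum_mono)
    fix m assume m: "m \<in> {1..X}"
    have "s m powr (-p) \<le> (\<bar>real_of_int (\<phi> m)\<bar> * (c / (2 * real X))) powr (-p)"
      using lower[OF m] assms c_pos False by (intro powr_mono2') auto
    also have "\<dots> = (c / (2 * real X)) powr (-p) * \<bar>real_of_int (\<phi> m)\<bar> powr (-p)"
      using c_pos by (subst powr_mult) auto
    finally show "s m powr (-p) \<le> (c / (2 * real X)) powr (-p) * \<bar>real_of_int (\<phi> m)\<bar> powr (-p)" .
  qed
  also have "\<dots> = (c / (2 * real X)) powr (-p) * (\<Sum>k\<in>\<phi> ` {1..X}. \<bar>real_of_int k\<bar> powr (-p))"
    by (subst sum.reindex[OF inj]) (simp add: sum_distrib_left)
  also have "\<dots> \<le> (c / (2 * real X)) powr (-p) * (2 * (\<Sum>n. real n powr (-p)))"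
    using assms by (intro mult_left_mono sum_int_powr_le) auto
  also have "(c / (2 * real X)) powr (-p) = (2 / c) powr p * real X powr p"
  proof -
    have "(c / (2 * real X)) powr (-p) = (inverse (c / (2 * real X))) powr p"
      using c_pos False by (simp add: powr_minus powr_divide powr_mult field_simps)
    also have "inverse (c / (2 * real X)) = 2 / c * real X" by simp
    also have "(2 / c * real X) powr p = (2 / c) powr p * real X powr p"
      by (rule powr_mult)
    finally show ?thesis .
  qed
  finally show ?thesis by (simp add: mult_ac)
qed simp

text \<open>
The bounds \<open>X powr 2\<close> and \<open>X powr (3/2)\<close> for the partial sums are those of \<open>m\<close> and of
\<open>sqrt m\<close>, up to constants, so these can replace the powers of \<open>s m\<close> under any decreasing weight.
\<close>
lemma weighted_sum_s_square:
  "\<exists>C>0. \<forall>w L. (\<forall>m\<ge>1. 0 \<le> w m \<and> w (Suc m) \<le> w m) \<longrightarrow>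
     (\<Sum>m=1..L. w m * (1 / (s m)\<^sup>2)) \<le> C * (\<Sum>m=1..L. w m * real m)"
proof -
  define C where "C = 2 * (2 / c) powr 2 * (\<Sum>n. real n powr (-2)) + 1"
  have C: "C > 0"
    unfolding C_def by (intro add_nonneg_pos mult_nonneg_nonneg suminf_nonneg)
      (auto simp: summable_real_powr_iff)
  have *: "(\<Sum>m=1..X. 1 / (s m)\<^sup>2) \<le> (\<Sum>m=1..X. C * (2 * real m))" for X
  proof -
    have "(\<Sum>m=1..X. 1 / (s m)\<^sup>2) = (\<Sum>m=1..X. s m powr (-2))"
      by (intro sum.cong refl) (use s_pos in \<open>auto simp: powr_minus divide_inverse less_imp_le Suc_le_eq\<close>)
    also have "\<dots> \<le> (C - 1) * real X powr 2"
      using sum_s_powr_le[of 2 X] by (simp add: C_def)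
    also have "\<dots> \<le> C * (real X)\<^sup>2"
      by (simp add: algebra_simps)
    also have "\<dots> \<le> C * (\<Sum>m=1..X. 2 * real m)"
      using C by (intro mult_left_mono square_le_sum_double) auto
    finally show ?thesis by (simp only: sum_distrib_left)
  qed
  show ?thesis
  proof (intro exI[of _ "2 * C"] conjI allI impI)
    fix w :: "nat \<Rightarrow> real" and L
    assume w: "\<forall>m\<ge>1. 0 \<le> w m \<and> w (Suc m) \<le> w m"
    have "(\<Sum>m=1..L. w m * (1 / (s m)\<^sup>2)) \<le> (\<Sum>m=1..L. w m * (C * (2 * real m)))"
      using w by (intro sum_antimono_weight_le *) auto
    also have "\<dots> = 2 * C * (\<Sum>m=1..L. w m * real m)"
      by (simp add: sum_distrib_left mult_ac)
    finally show "(\<Sum>m=1..L. w m * (1 / (s m)\<^sup>2)) \<le> 2 * C * (\<Sum>m=1..L. w m * real m)" .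
  qed (use C in simp)
qed

lemma weighted_sum_s_three_halves:
  "\<exists>C>0. \<forall>w L. (\<forall>m\<ge>1. 0 \<le> w m \<and> w (Suc m) \<le> w m) \<longrightarrow>
     (\<Sum>m=1..L. w m * s m powr (-3/2)) \<le> C * (\<Sum>m=1..L. w m * sqrt (real m))"
proof -
  define C where "C = 2 * (2 / c) powr (3/2) * (\<Sum>n. real n powr (-3/2)) + 1"
  have C: "C > 0"
    unfolding C_def by (intro add_nonneg_pos mult_nonneg_nonneg suminf_nonneg)
      (auto simp: summable_real_powr_iff)
  have *: "(\<Sum>m=1..X. s m powr (-3/2)) \<le> (\<Sum>m=1..X. C * (2 * sqrt (real m)))" for X
  proof -
    have pw: "real X powr (3/2) = real X * sqrt (real X)"
    proof (cases "X = 0")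
      case False
      have "real X powr (3/2) = real X powr (1 + 1/2)" by simp
      also have "\<dots> = real X powr 1 * real X powr (1/2)" by (rule powr_add)
      finally show ?thesis using False by (simp add: powr_half_sqrt)
    qed simp
    have "(\<Sum>m=1..X. s m powr (-3/2)) \<le> (C - 1) * real X powr (3/2)"
      using sum_s_powr_le[of "3/2" X] by (simp add: C_def)
    also have "\<dots> \<le> C * (real X * sqrt (real X))"
      unfolding pw by (intro mult_right_mono) auto
    also have "\<dots> \<le> C * (\<Sum>m=1..X. 2 * sqrt (real m))"
      using C by (intro mult_left_mono mult_sqrt_le_sum_sqrt) auto
    finally show ?thesis by (simp only: sum_distrib_left)
  qed
  show ?thesis
  proof (intro exI[of _ "2 * C"] conjI allI impI)
    fix w :: "nat \<Rightarrow> real" and L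
    assume w: "\<forall>m\<ge>1. 0 \<le> w m \<and> w (Suc m) \<le> w m"
    have "(\<Sum>m=1..L. w m * s m powr (-3/2)) \<le> (\<Sum>m=1..L. w m * (C * (2 * sqrt (real m))))"
      using w by (intro sum_antimono_weight_le *) auto
    also have "\<dots> = 2 * C * (\<Sum>m=1..L. w m * sqrt (real m))"
      by (simp add: sum_distrib_left mult_ac)
    finally show "(\<Sum>m=1..L. w m * s m powr (-3/2)) \<le> 2 * C * (\<Sum>m=1..L. w m * sqrt (real m))" .
  qed (use C in simp)
qed

lemma power_over_nat_antimono:
  fixes r :: real
  assumes "0 \<le> r" "r \<le> 1" "m \<ge> 1"
  shows "0 \<le> r ^ m / real m \<and> r ^ Suc m / real (Suc m) \<le> r ^ m / real m"
  using assms by (auto intro!: frac_le mult_left_le_one_le)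

text \<open>
The weights that occur are \<open>1 / m\<close> and \<open>r ^ m / m\<close>.  In the last bound \<open>K\<close> is, up to a constant, the
length at which \<open>\<rho> ^ m\<close> cuts the sum off; keeping it separate from \<open>\<rho>\<close> allows \<open>\<rho>\<close> to be a square
root of \<open>1 - 1 / K\<close>.
\<close>
lemma exists_sum_constants:
  obtains C where "C > 0"
    and "\<And>X. (\<Sum>m=1..X. 1 / (real m * (s m)\<^sup>2)) \<le> C * real X"
    and "\<And>r L. 0 \<le> r \<Longrightarrow> r < 1 \<Longrightarrow> (\<Sum>m=1..L. r ^ m / (real m * (s m)\<^sup>2)) \<le> C / (1 - r)"
    and "\<And>\<rho> L K. 0 \<le> \<rho> \<Longrightarrow> \<rho> < 1 \<Longrightarrow> K > 0 \<Longrightarrow> 1 / (1 - \<rho>) \<le> 2 * real K \<Longrightarrow>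
           (\<Sum>m=1..L. \<rho> ^ m / real m * s m powr (-3/2)) \<le> C * sqrt (real K)"
proof -
  from weighted_sum_s_square obtain C1 where C1: "C1 > 0"
    "\<And>w L. \<forall>m\<ge>1. 0 \<le> w m \<and> w (Suc m) \<le> w m \<Longrightarrow>
     (\<Sum>m=1..L. w m * (1 / (s m)\<^sup>2)) \<le> C1 * (\<Sum>m=1..L. w m * real m)" by blast
  from weighted_sum_s_three_halves obtain C2 where C2: "C2 > 0"
    "\<And>w L. \<forall>m\<ge>1. 0 \<le> w m \<and> w (Suc m) \<le> w m \<Longrightarrow>
     (\<Sum>m=1..L. w m * s m powr (-3/2)) \<le> C2 * (\<Sum>m=1..L. w m * sqrt (real m))" by blast
  have C1': "(\<Sum>m=1..L. r ^ m / (real m * (s m)\<^sup>2)) \<le> C1 * (\<Sum>m=1..L. r ^ m)"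
    if "0 \<le> r" "r \<le> 1" for r L
  proof -
    have "(\<Sum>m=1..L. r ^ m / (real m * (s m)\<^sup>2)) = (\<Sum>m=1..L. r ^ m / real m * (1 / (s m)\<^sup>2))"
      by simp
    also have "\<dots> \<le> C1 * (\<Sum>m=1..L. r ^ m / real m * real m)"
      by (intro C1(2) allI impI power_over_nat_antimono that)
    also have "(\<Sum>m=1..L. r ^ m / real m * real m) = (\<Sum>m=1..L. r ^ m)"
      by (intro sum.cong) auto
    finally show ?thesis .
  qed
  show ?thesis
  proof (rule that[of "C1 + 4 * C2"])
    show "C1 + 4 * C2 > 0" using C1 C2 by simp
    show "(\<Sum>m=1..X. 1 / (real m * (s m)\<^sup>2)) \<le> (C1 + 4 * C2) * real X" for X
    proof -
      have "(\<Sum>m=1..X. 1 / (real m * (s m)\<^sup>2)) \<le> C1 * real X"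
        using C1'[of 1 X] by simp
      also have "\<dots> \<le> (C1 + 4 * C2) * real X" using C2 by (intro mult_right_mono) auto
      finally show ?thesis .
    qed
    show "(\<Sum>m=1..L. r ^ m / (real m * (s m)\<^sup>2)) \<le> (C1 + 4 * C2) / (1 - r)"
      if "0 \<le> r" "r < 1" for r L
    proof -
      have "(\<Sum>m=1..L. r ^ m / (real m * (s m)\<^sup>2)) \<le> C1 * (\<Sum>m=1..L. r ^ m)"
        using C1'[of r L] that by simp
      also have "\<dots> \<le> (C1 + 4 * C2) * (1 / (1 - r))"
        using C1 C2 that by (intro mult_mono sum_power_le sum_nonneg) auto
      finally show ?thesis by simp
    qed
    show "(\<Sum>m=1..L. \<rho> ^ m / real m * s m powr (-3/2)) \<le> (C1 + 4 * C2) * sqrt (real K)"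
      if "0 \<le> \<rho>" "\<rho> < 1" "K > 0" "1 / (1 - \<rho>) \<le> 2 * real K" for \<rho> L K
    proof -
      have "(\<Sum>m=1..L. \<rho> ^ m / real m * s m powr (-3/2))
          \<le> C2 * (\<Sum>m=1..L. \<rho> ^ m / real m * sqrt (real m))"
        using that by (intro C2(2) allI impI power_over_nat_antimono) auto
      also have "(\<Sum>m=1..L. \<rho> ^ m / real m * sqrt (real m)) = (\<Sum>m=1..L. \<rho> ^ m / sqrt (real m))"
        by (intro sum.cong refl) (simp add: field_simps)
      also have "C2 * \<dots> \<le> C2 * (4 * sqrt (real K))"
        using C2 that by (intro mult_left_mono sum_power_over_sqrt_le) auto
      also have "\<dots> \<le> (C1 + 4 * C2) * sqrt (real K)"
        using C1 by (simp add: distrib_right)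
      finally show ?thesis .
    qed
  qed
qed

end

section \<open>The second moment of the oscillating part\<close>

text \<open>
This splits a product of three denominators, one of which is the sum or difference of the other
two frequencies, into products of only two, at the price of the exponent \<open>3/2\<close>.  Any exponent
strictly between \<open>1\<close> and \<open>2\<close> would do; the exponents \<open>1\<close> and \<open>2\<close> themselves would cost a power of
\<open>ln M\<close>.  In terms of square roots the claim is \<open>a * e * b \<le> a ^ 3 + e ^ 3\<close> for \<open>b \<le> a + e\<close>.
\<close>
lemma triple_product_le:
  fixes x y z :: real
  assumes "0 < x" "0 < y" "0 < z" "y \<le> x + z"
  shows "1 / (x * y * z) \<le> y powr (-3/2) * (x powr (-3/2) + z powr (-3/2))"
proof -
  define a b e where "a = sqrt x" and "b = sqrt y" and "e = sqrt z"
  have pos: "0 < a" "0 < b" "0 < e" using assms by (simp_all add: a_def b_def e_def)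
  have sq: "x = a\<^sup>2" "y = b\<^sup>2" "z = e\<^sup>2" using assms by (simp_all add: a_def b_def e_def)
  have pw: "t powr (-3/2) = 1 / (sqrt t) ^ 3" if "0 < t" for t :: real
  proof -
    have "t powr (-3/2) = t powr ((1/2) * (- 3))" by simp
    also have "\<dots> = (sqrt t) powr (- real 3)"
      using that by (simp only: powr_powr[symmetric]) (simp add: powr_half_sqrt)
    also have "\<dots> = 1 / (sqrt t) ^ 3"
      using that by (simp only: powr_minus powr_realpow real_sqrt_gt_zero) (simp add: divide_inverse)
    finally show ?thesis .
  qed
  have "b\<^sup>2 \<le> a\<^sup>2 + e\<^sup>2" using assms sq by simp
  also have "\<dots> \<le> (a + e)\<^sup>2" using pos by (simp add: power2_sum)
  finally have "b \<le> a + e" using pos by (intro power2_le_imp_le[of b]) auto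
  hence "a * e * b \<le> a * e * (a + e)" using pos by (intro mult_left_mono) auto
  also have "\<dots> \<le> a ^ 3 + e ^ 3"
  proof -
    have "0 \<le> (a + e) * (a - e)\<^sup>2" using pos by simp
    also have "\<dots> = a ^ 3 + e ^ 3 - a * e * (a + e)" by algebra
    finally show ?thesis by simp
  qed
  finally have key: "a * e * b \<le> a ^ 3 + e ^ 3" .
  have "1 / (x * y * z) = (a * e * b) / (a ^ 3 * b ^ 3 * e ^ 3)"
    using pos unfolding sq by (simp add: divide_simps eval_nat_numeral)
  also have "\<dots> \<le> (a ^ 3 + e ^ 3) / (a ^ 3 * b ^ 3 * e ^ 3)"
    using key pos by (intro divide_right_mono) auto
  also have "\<dots> = 1 / b ^ 3 * (1 / a ^ 3 + 1 / e ^ 3)"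
    using pos by (simp add: divide_simps)
  finally show ?thesis using assms by (simp only: pw a_def b_def e_def)
qed

lemma sum_sin_odd_mult_le:
  fixes x y :: real
  assumes "sin (x - y) \<noteq> 0" "sin (x + y) \<noteq> 0"
  shows "\<bar>\<Sum>N=1..M. sin ((2 * real N + 1) * x) * sin ((2 * real N + 1) * y)\<bar>
      \<le> (1 / \<bar>sin (x - y)\<bar> + 1 / \<bar>sin (x + y)\<bar>) / 2"
proof -
  have "sin ((2 * real N + 1) * x) * sin ((2 * real N + 1) * y)
      = (cos ((2 * real N + 1) * (x - y)) - cos ((2 * real N + 1) * (x + y))) / 2" for N
    unfolding sin_times_sin by (simp only: right_diff_distrib distrib_left)
  hence eq: "(\<Sum>N=1..M. sin ((2 * real N + 1) * x) * sin ((2 * real N + 1) * y))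
      = ((\<Sum>N=1..M. cos ((2 * real N + 1) * (x - y)))
          - (\<Sum>N=1..M. cos ((2 * real N + 1) * (x + y)))) / 2"
    by (simp only: sum_divide_distrib[symmetric] sum_subtractf)
  show ?thesis
    unfolding eq
    using abs_sum_cos_odd_le[OF assms(1), of 1 M] abs_sum_cos_odd_le[OF assms(2), of 1 M]
    by (simp add: divide_right_mono)
qed

lemma sum_sin_odd_square_le:
  fixes x :: real
  assumes "sin (2 * x) \<noteq> 0"
  shows "\<bar>(\<Sum>N=1..M. (sin ((2 * real N + 1) * x))\<^sup>2) - real M / 2\<bar> \<le> (1 / \<bar>sin (2 * x)\<bar>) / 2"
proof -
  have "(sin ((2 * real N + 1) * x))\<^sup>2 = 1 / 2 - cos ((2 * real N + 1) * (2 * x)) / 2" for N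
  proof -
    have "(2 * real N + 1) * (2 * x) = 2 * ((2 * real N + 1) * x)" by simp
    thus ?thesis using cos_double_sin[of "(2 * real N + 1) * x"] by (simp only:) (simp add: diff_divide_distrib)
  qed
  hence eq: "(\<Sum>N=1..M. (sin ((2 * real N + 1) * x))\<^sup>2) - real M / 2
      = - (\<Sum>N=1..M. cos ((2 * real N + 1) * (2 * x))) / 2"
    by (simp only: sum_subtractf sum_divide_distrib[symmetric]) simp
  show ?thesis unfolding eq
    using abs_sum_cos_odd_le[OF assms, of 1 M] by (simp add: divide_right_mono)
qed

text \<open>
The difference equals \<open>- ln (r + u) / 2\<close> with \<open>u = (1 - r)\<^sup>2 / (4 * t\<^sup>2)\<close>: the smoothing is visible
only where \<open>t\<close> is of order \<open>1 / M\<close>.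
\<close>
lemma log_two_sin_approx:
  fixes t :: real
  assumes "M \<ge> 2" "t \<noteq> 0"
  defines "r \<equiv> 1 - 1 / real M"
  shows "\<bar>ln \<bar>2 * t\<bar> - ln ((1 - r)\<^sup>2 + 4 * r * t\<^sup>2) / 2\<bar> \<le> 1 / ((real M)\<^sup>2 * t\<^sup>2) + 1 / real M"
proof -
  have M: "real M \<ge> 2" using assms by simp
  define u where "u = (1 - r)\<^sup>2 / (4 * t\<^sup>2)"
  have u: "0 \<le> u" "u = 1 / ((real M)\<^sup>2 * (4 * t\<^sup>2))"
    by (simp_all add: u_def r_def power_divide)
  have r: "1 / 2 \<le> r" "r < 1" using M by (auto simp: r_def field_simps)
  have "(1 - r)\<^sup>2 + 4 * r * t\<^sup>2 = (2 * t)\<^sup>2 * (r + u)"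
    using assms(2) by (simp add: u_def field_simps power2_eq_square)
  hence "ln ((1 - r)\<^sup>2 + 4 * r * t\<^sup>2) = ln ((2 * t)\<^sup>2) + ln (r + u)"
    using assms(2) r u(1) by (simp add: ln_mult)
  also have "ln ((2 * t)\<^sup>2) = ln (\<bar>2 * t\<bar> ^ 2)" by simp
  also have "\<dots> = 2 * ln \<bar>2 * t\<bar>"
    using assms(2) by (subst ln_realpow) auto
  finally have "ln ((1 - r)\<^sup>2 + 4 * r * t\<^sup>2) = 2 * ln \<bar>2 * t\<bar> + ln (r + u)" .
  hence eq: "ln \<bar>2 * t\<bar> - ln ((1 - r)\<^sup>2 + 4 * r * t\<^sup>2) / 2 = - ln (r + u) / 2" by linarith
  have "ln (r + u) \<le> r + u - 1" using r u(1) by (intro ln_le_minus_one) auto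
  also have "\<dots> \<le> u" using r by simp
  finally have up: "ln (r + u) \<le> u" .
  have "- ln (r + u) \<le> - ln r" using r u(1) by simp
  also have "- ln r = ln (1 / r)" using r by (simp add: ln_div)
  also have "\<dots> \<le> 1 / r - 1" using r by (intro ln_le_minus_one) auto
  also have "\<dots> = (1 - r) / r" using r by (simp add: diff_divide_distrib)
  also have "\<dots> \<le> (1 - r) / (1 / 2)" using r by (intro divide_left_mono) auto
  also have "\<dots> = 2 / real M" by (simp add: r_def)
  finally have lo: "- ln (r + u) \<le> 2 / real M" .
  have "u / 2 \<le> 1 / ((real M)\<^sup>2 * t\<^sup>2)"
    using M assms(2) unfolding u(2) by (simp add: divide_simps)
  moreover have "0 \<le> 1 / ((real M)\<^sup>2 * t\<^sup>2)" "0 \<le> 1 / real M" by simp_all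
  moreover have "2 / real M = 2 * (1 / real M)" by simp
  ultimately show ?thesis unfolding eq using up lo by linarith
qed

context badly_approximable
begin

text \<open>
The oscillating part \<open>a\<^sub>N\<close>, truncated at \<open>L\<close>.  All bounds below are uniform in \<open>L\<close>, so that
\<open>L\<close> can be sent to infinity at the end without manipulating infinite double sums.
\<close>
definition osc_sum :: "real \<Rightarrow> nat \<Rightarrow> nat \<Rightarrow> real" where
  "osc_sum r L N = - (\<Sum>m=1..L. r ^ m / real m *
     (sin ((2 * real N + 1) * (pi * real m * \<alpha>)) / (2 * sin (pi * real m * \<alpha>))))"

text \<open>
Summation over \<open>N\<close> gains a second factor \<open>1 / s m\<close>, and \<open>\<Sum>m. r ^ m / (m * (s m)\<^sup>2)\<close> is of order
\<open>1 / (1 - r) = M\<close>.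
\<close>
lemma osc_sum_tail_le:
  "\<exists>C>0. \<forall>M L n. M \<ge> 2 \<longrightarrow> n \<le> Suc M \<longrightarrow>
     \<bar>\<Sum>N=n..M. osc_sum (1 - 1 / real M) L N\<bar> \<le> C * real M"
proof -
  obtain C where C: "C > 0" "\<And>r L. 0 \<le> r \<Longrightarrow> r < 1 \<Longrightarrow> (\<Sum>m=1..L. r ^ m / (real m * (s m)\<^sup>2)) \<le> C / (1 - r)"
    by (rule exists_sum_constants) blast
  show ?thesis
  proof (intro exI[of _ C] conjI allI impI)
    fix M L n :: nat
    assume M: "M \<ge> 2" and n: "n \<le> Suc M"
    define r where "r = 1 - 1 / real M"
    have r: "0 \<le> r" "r < 1" "1 / (1 - r) = real M" using M by (auto simp: r_def)
    have "(\<Sum>N=n..M. osc_sum r L N)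
        = - (\<Sum>m=1..L. \<Sum>N=n..M. r ^ m / real m *
     (sin ((2 * real N + 1) * (pi * real m * \<alpha>)) / (2 * sin (pi * real m * \<alpha>))))"
      unfolding osc_sum_def sum_negf by (subst sum.swap) (rule refl)
    also have "\<dots> = - (\<Sum>m=1..L. r ^ m / real m / (2 * sin (pi * real m * \<alpha>)) *
        (\<Sum>N=n..M. sin ((2 * real N + 1) * (pi * real m * \<alpha>))))"
      unfolding sum_distrib_left by (simp add: mult_ac)
    finally have "\<bar>\<Sum>N=n..M. osc_sum r L N\<bar>
        = \<bar>\<Sum>m=1..L. r ^ m / real m / (2 * sin (pi * real m * \<alpha>)) *
        (\<Sum>N=n..M. sin ((2 * real N + 1) * (pi * real m * \<alpha>)))\<bar>"
      by (simp only: abs_minus_cancel)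
    also have "\<dots> \<le> (\<Sum>m=1..L. r ^ m / (real m * (s m)\<^sup>2))"
    proof (rule order.trans[OF sum_abs], rule sum_mono)
      fix m assume m: "m \<in> {1..L}"
      have "\<bar>r ^ m / real m / (2 * sin (pi * real m * \<alpha>)) *
        (\<Sum>N=n..M. sin ((2 * real N + 1) * (pi * real m * \<alpha>)))\<bar>
        = r ^ m / real m / (2 * s m) * \<bar>\<Sum>N=n..M. sin ((2 * real N + 1) * (pi * real m * \<alpha>))\<bar>"
        using r by (simp add: abs_mult s_def)
      also have "\<dots> \<le> r ^ m / real m / (s m) * (1 / s m)"
        using abs_sum_sin_odd_le[OF sin_nonzero n, of m] m r s_pos[of m]
        by (intro mult_mono divide_left_mono) (auto simp: s_def)
      also have "\<dots> = r ^ m / (real m * (s m)\<^sup>2)"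
        by (simp add: power2_eq_square)
      finally show "\<bar>r ^ m / real m / (2 * sin (pi * real m * \<alpha>)) *
        (\<Sum>N=n..M. sin ((2 * real N + 1) * (pi * real m * \<alpha>)))\<bar> \<le> r ^ m / (real m * (s m)\<^sup>2)" .
    qed
    also have "\<dots> \<le> C / (1 - r)" using r by (intro C(2)) auto
    also have "C / (1 - r) = C * real M" using r(3) by (simp add: divide_inverse)
    finally show "\<bar>\<Sum>N=n..M. osc_sum (1 - 1 / real M) L N\<bar> \<le> C * real M" by (simp only: r_def)
  qed (use C in simp)
qed

text \<open>
An off-diagonal term with frequencies \<open>m\<close>, \<open>m'\<close> and \<open>k = m' - m\<close> or \<open>k = m + m'\<close>, where \<open>m \<le> m'\<close>.
Splitting it by \<open>triple_product_le\<close> with \<open>m\<close> as the distinguished index, and using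
\<open>1 / m' \<le> 2 / k\<close>, separates the variables.  Taking \<open>\<rho>\<close> to be the square root of \<open>r\<close> leaves enough
decay for both factors: \<open>r ^ (m + m') = \<rho> ^ (2 * m + 2 * m')\<close> is at most \<open>\<rho> ^ m * \<rho> ^ k\<close> for either \<open>k\<close>.
\<close>
lemma off_diagonal_term_le:
  fixes \<rho> :: real
  defines "F \<equiv> (\<lambda>k. \<rho> ^ k / real k * s k powr (-3/2))"
  assumes \<rho>: "0 \<le> \<rho>" "\<rho> < 1" and pos: "0 < m" "0 < m'" "0 < k"
    and k: "k \<le> 2 * m'" "s m \<le> s m' + s k"
  shows "(\<rho>\<^sup>2) ^ m / (real m * s m) * ((\<rho>\<^sup>2) ^ m' / (real m' * s m')) * (1 / s k) \<le> F m * (F m' + 2 * F k)"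
proof -
  have sp: "0 < s m" "0 < s m'" "0 < s k" using pos by (auto intro: s_pos)
  define Y X Z where "Y = s m powr (-3/2)" and "X = s m' powr (-3/2)" and "Z = s k powr (-3/2)"
  have nn: "0 \<le> Y" "0 \<le> X" "0 \<le> Z" by (auto simp: Y_def X_def Z_def)
  have "(\<rho>\<^sup>2) ^ m / (real m * s m) * ((\<rho>\<^sup>2) ^ m' / (real m' * s m')) * (1 / s k)
      = \<rho> ^ (2 * m + 2 * m') / (real m * real m') * (1 / (s m' * s m * s k))"
    by (simp add: power_mult power_add)
  also have "\<dots> \<le> \<rho> ^ (2 * m + 2 * m') / (real m * real m') * (Y * (X + Z))"
    unfolding X_def Y_def Z_def using \<rho> sp k(2) by (intro mult_left_mono triple_product_le) auto
  also have "\<dots> = \<rho> ^ (2 * m + 2 * m') / (real m * real m') * (Y * X)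
      + \<rho> ^ (2 * m + 2 * m') / (real m * real m') * (Y * Z)"
    by (simp only: distrib_left)
  also have "\<dots> \<le> \<rho> ^ (m + m') / (real m * real m') * (Y * X)
      + \<rho> ^ (m + k) / (real m * (real k / 2)) * (Y * Z)"
    using \<rho> pos nn k(1) by (intro add_mono mult_right_mono frac_le power_decreasing mult_left_mono) auto
  also have "\<dots> = F m * (F m' + 2 * F k)"
    unfolding F_def X_def[symmetric] Y_def[symmetric] Z_def[symmetric]
    by (simp add: power_add distrib_left add_divide_distrib mult_ac)
  finally show ?thesis .
qed

text \<open>
Expanding the square, the off-diagonal pairs with \<open>m \<le> m'\<close> (and the double frequency \<open>2 * m\<close> on
the diagonal) are dominated by \<open>F m * F k\<close> for three different \<open>k\<close>; each of the three sums is at most \<open>E\<^sup>2\<close>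
with \<open>E = O(sqrt M)\<close>.
\<close>
lemma osc_sum_second_moment:
  "\<exists>C>0. \<forall>M L. M \<ge> 2 \<longrightarrow>
     \<bar>(\<Sum>N=1..M. (osc_sum (1 - 1 / real M) L N)\<^sup>2)
       - real M / 8 * (\<Sum>m=1..L. (1 - 1 / real M) ^ (2 * m) / ((real m)\<^sup>2 * (s m)\<^sup>2))\<bar> \<le> C * real M"
proof -
  obtain C where C: "C > 0" "\<And>\<rho> L K. 0 \<le> \<rho> \<Longrightarrow> \<rho> < 1 \<Longrightarrow> K > 0 \<Longrightarrow> 1 / (1 - \<rho>) \<le> 2 * real K \<Longrightarrow>
           (\<Sum>m=1..L. \<rho> ^ m / real m * s m powr (-3/2)) \<le> C * sqrt (real K)"
    by (rule exists_sum_constants) blast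
  show ?thesis
  proof (intro exI[of _ "3 * C\<^sup>2"] conjI allI impI)
    fix M L :: nat
    assume M: "M \<ge> 2"
    define r where "r = 1 - 1 / real M"
    define \<rho> where "\<rho> = sqrt r"
    have r: "0 \<le> r" "r < 1" "1 / (1 - r) = real M" using M by (auto simp: r_def)
    have \<rho>: "0 \<le> \<rho>" "\<rho> < 1" "\<rho>\<^sup>2 = r" using r by (auto simp: \<rho>_def)
    have \<rho>M: "1 / (1 - \<rho>) \<le> 2 * real M"
    proof -
      have "1 - r = (1 - \<rho>) * (1 + \<rho>)" using \<rho>(3) by (simp add: algebra_simps power2_eq_square)
      also have "\<dots> \<le> (1 - \<rho>) * 2" using \<rho> by (intro mult_left_mono) auto
      finally have "1 / (1 - \<rho>) \<le> 2 * (1 / (1 - r))" using \<rho> r by (simp add: field_simps)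
      thus ?thesis using r(3) by simp
    qed
    define F where "F = (\<lambda>k. \<rho> ^ k / real k * s k powr (-3/2))"
    have F0: "0 \<le> F k" for k using \<rho> by (simp add: F_def)
    define E where "E = (\<Sum>k\<le>2*L. F k)"
    have E0: "0 \<le> E" unfolding E_def by (intro sum_nonneg F0)
    have "E = (\<Sum>k=1..2*L. F k)"
    proof -
      have "{..2*L} = insert 0 {1..2*L}" by auto
      thus ?thesis by (simp add: E_def F_def)
    qed
    hence E: "E \<le> C * sqrt (real M)"
      using C(2)[OF \<rho>(1,2) _ \<rho>M, of "2 * L"] M by (simp add: F_def)
    have sub: "(\<Sum>x\<in>A. F (g x)) \<le> E" if "finite A" "inj_on g A" "g ` A \<subseteq> {..2*L}" for A :: "nat set" and g
    proof -
      have "(\<Sum>x\<in>A. F (g x)) = (\<Sum>k\<in>g ` A. F k)" by (simp add: sum.reindex[OF that(2)])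
      also have "\<dots> \<le> E" unfolding E_def using that F0 by (intro sum_mono2) auto
      finally show ?thesis .
    qed
    define f where "f m = r ^ m / (real m * sin (pi * real m * \<alpha>))" for m
    define S where "S m m' = (\<Sum>N=1..M. sin ((2 * real N + 1) * (pi * real m * \<alpha>)) *
       sin ((2 * real N + 1) * (pi * real m' * \<alpha>)))" for m m'
    define H where "H m m' = f m * f m' * (S m m' - (if m = m' then real M / 2 else 0))" for m m'
    have H_sym: "H m m' = H m' m" for m m'
      by (simp add: H_def S_def mult.commute)
    define G where "G m m' = (if m \<le> m' then F m * (F m' + F (m' - m) + F (m + m')) else 0) * 2" for m m'
    have G0: "0 \<le> G m m'" for m m' using F0 by (simp add: G_def)
    have absf: "\<bar>f m\<bar> = r ^ m / (real m * s m)" for m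
      using r by (simp add: f_def s_def abs_mult)
    have H_le: "\<bar>H m m'\<bar> \<le> G m m'" if "1 \<le> m" "m \<le> m'" for m m'
    proof -
      have plus: "\<bar>f m\<bar> * \<bar>f m'\<bar> * (1 / s (m + m')) \<le> F m * (F m' + 2 * F (m + m'))"
        unfolding absf F_def \<rho>(3)[symmetric]
        using that \<rho> s_le_add_sum[of m m'] by (intro off_diagonal_term_le) auto
      show ?thesis
      proof (cases "m = m'")
        case True
        have eq: "sin (2 * (pi * real m * \<alpha>)) = sin (pi * real (m + m') * \<alpha>)"
          using True by (simp add: algebra_simps)
        have nz: "sin (2 * (pi * real m * \<alpha>)) \<noteq> 0"
          unfolding eq using that by (intro sin_nonzero) auto
        have "\<bar>S m m' - real M / 2\<bar> \<le> (1 / s (m + m')) / 2"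
          using sum_sin_odd_square_le[OF nz, of M] unfolding eq s_def S_def True[symmetric]
          by (simp add: power2_eq_square)
        also have "\<dots> \<le> 1 / s (m + m')" using s_pos[of "m + m'"] that by (simp add: field_simps)
        finally have "\<bar>H m m'\<bar> \<le> \<bar>f m\<bar> * \<bar>f m'\<bar> * (1 / s (m + m'))"
          using True by (simp only: H_def abs_mult if_True) (intro mult_left_mono; simp)
        also have "\<dots> \<le> F m * (F m' + 2 * F (m + m'))" by (rule plus)
        also have "\<dots> \<le> G m m'"
        proof -
          have "F m * (F m' + 2 * F (m + m')) \<le> F m * ((F m' + F (m' - m) + F (m + m')) * 2)"
            using F0[of m'] F0[of "m' - m"] by (intro mult_left_mono F0) simp
          thus ?thesis using that by (simp only: G_def if_True mult.assoc)
        qed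
        finally show ?thesis .
      next
        case False
        hence lt: "m < m'" using that by simp
        have minus: "\<bar>f m\<bar> * \<bar>f m'\<bar> * (1 / s (m' - m)) \<le> F m * (F m' + 2 * F (m' - m))"
          unfolding absf F_def \<rho>(3)[symmetric]
          using that lt \<rho> s_le_add_sum[of m "m' - m"] by (intro off_diagonal_term_le) auto
        have eq1: "sin (pi * real m * \<alpha> - pi * real m' * \<alpha>) = - sin (pi * real (m' - m) * \<alpha>)"
          using lt by (simp add: of_nat_diff algebra_simps flip: sin_minus)
        have eq2: "sin (pi * real m * \<alpha> + pi * real m' * \<alpha>) = sin (pi * real (m + m') * \<alpha>)"
          by (simp add: algebra_simps)
        have nz: "sin (pi * real m * \<alpha> - pi * real m' * \<alpha>) \<noteq> 0"
            "sin (pi * real m * \<alpha> + pi * real m' * \<alpha>) \<noteq> 0"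
          unfolding eq1 eq2 neg_equal_0_iff_equal by (rule sin_nonzero, use that lt in simp)+
        have "\<bar>S m m'\<bar> \<le> (1 / s (m' - m) + 1 / s (m + m')) / 2"
          using sum_sin_odd_mult_le[OF nz, of M] unfolding eq1 eq2 S_def s_def by simp
        hence "\<bar>H m m'\<bar> \<le> \<bar>f m\<bar> * \<bar>f m'\<bar> * ((1 / s (m' - m) + 1 / s (m + m')) / 2)"
          using False by (simp only: H_def abs_mult if_False diff_zero) (intro mult_left_mono; simp)
        also have "\<dots> = (\<bar>f m\<bar> * \<bar>f m'\<bar> * (1 / s (m' - m)) + \<bar>f m\<bar> * \<bar>f m'\<bar> * (1 / s (m + m'))) / 2"
          by (simp add: distrib_left)
        also have "\<dots> \<le> (F m * (F m' + 2 * F (m' - m)) + F m * (F m' + 2 * F (m + m'))) / 2"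
          using plus minus by (intro divide_right_mono add_mono) auto
        also have "\<dots> = F m * (F m' + F (m' - m) + F (m + m'))"
          by (simp add: algebra_simps)
        also have "\<dots> \<le> G m m'"
          using that F0 by (simp add: G_def)
        finally show ?thesis .
      qed
    qed
    have G_sum: "(\<Sum>m=1..L. \<Sum>m'=1..L. G m m') \<le> 6 * E\<^sup>2"
    proof -
      have "(\<Sum>m'=1..L. G m m') \<le> F m * (6 * E)" if m: "m \<in> {1..L}" for m
      proof -
        have "(\<Sum>m'=1..L. G m m') = (\<Sum>m'=m..L. G m m')"
          using m by (intro sum.mono_neutral_right) (auto simp: G_def)
        also have "\<dots> = (\<Sum>m'=m..L. F m * (2 * (F m' + F (m' - m) + F (m + m'))))"
          by (intro sum.cong) (auto simp: G_def)
        also have "\<dots> = F m * (2 * ((\<Sum>m'=m..L. F m') + (\<Sum>m'=m..L. F (m' - m)) + (\<Sum>m'=m..L. F (m + m'))))"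
          by (simp only: sum_distrib_left[symmetric] sum.distrib)
        also have "\<dots> \<le> F m * (2 * (E + E + E))"
          using m by (intro mult_left_mono add_mono sub F0) (auto simp: inj_on_def)
        finally show ?thesis by simp
      qed
      hence "(\<Sum>m=1..L. \<Sum>m'=1..L. G m m') \<le> (\<Sum>m=1..L. F m * (6 * E))" by (rule sum_mono)
      also have "\<dots> = (\<Sum>m=1..L. F m) * (6 * E)" by (simp only: sum_distrib_right)
      also have "\<dots> \<le> E * (6 * E)" using E0 by (intro mult_right_mono sub) auto
      finally show ?thesis by (simp add: power2_eq_square)
    qed
    have osc: "osc_sum r L N = - (\<Sum>m=1..L. f m * sin ((2 * real N + 1) * (pi * real m * \<alpha>))) / 2" for N
      unfolding osc_sum_def f_def minus_divide_left[symmetric] sum_divide_distrib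
      by (intro arg_cong[where f = uminus] sum.cong refl) simp
    have osc2: "(osc_sum r L N)\<^sup>2 = (\<Sum>m=1..L. \<Sum>m'=1..L. f m * f m' *
        (sin ((2 * real N + 1) * (pi * real m * \<alpha>)) * sin ((2 * real N + 1) * (pi * real m' * \<alpha>)))) / 4" for N
    proof -
      have "(- x / 2)\<^sup>2 = x * x / 4" for x :: real by (simp add: power2_eq_square)
      thus ?thesis unfolding osc
        by (simp only: mult.assoc mult.left_commute sum_product)
    qed
    have "(\<Sum>N=1..M. (osc_sum r L N)\<^sup>2)
        = (\<Sum>N=1..M. (\<Sum>m=1..L. \<Sum>m'=1..L. f m * f m' * (sin ((2 * real N + 1) * (pi * real m * \<alpha>))
           * sin ((2 * real N + 1) * (pi * real m' * \<alpha>))))) / 4"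
      by (simp only: osc2 sum_divide_distrib[symmetric])
    also have "(\<Sum>N=1..M. (\<Sum>m=1..L. \<Sum>m'=1..L. f m * f m' * (sin ((2 * real N + 1) * (pi * real m * \<alpha>))
           * sin ((2 * real N + 1) * (pi * real m' * \<alpha>))))) = (\<Sum>m=1..L. \<Sum>m'=1..L. f m * f m' * S m m')"
      unfolding S_def sum_distrib_left
      by (rule trans[OF sum.swap]) (rule sum.cong[OF refl], rule sum.swap)
    also have "(\<Sum>m=1..L. \<Sum>m'=1..L. f m * f m' * S m m')
        = (\<Sum>m=1..L. \<Sum>m'=1..L. H m m' + (if m = m' then (f m)\<^sup>2 * (real M / 2) else 0))"
      by (intro sum.cong refl) (simp add: H_def algebra_simps power2_eq_square)
    also have "\<dots> = (\<Sum>m=1..L. \<Sum>m'=1..L. H m m') + real M / 2 * (\<Sum>m=1..L. (f m)\<^sup>2)"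
      by (simp add: sum.distrib sum_distrib_left mult.commute)
    also have "(\<Sum>m=1..L. (f m)\<^sup>2) = (\<Sum>m=1..L. r ^ (2 * m) / ((real m)\<^sup>2 * (s m)\<^sup>2))"
    proof (intro sum.cong refl)
      fix m
      have "r ^ (2 * m) = (r ^ m)\<^sup>2" by (simp add: power_mult[symmetric] mult.commute)
      thus "(f m)\<^sup>2 = r ^ (2 * m) / ((real m)\<^sup>2 * (s m)\<^sup>2)"
        by (simp add: f_def s_def power_divide power_mult_distrib)
    qed
    finally have eq: "(\<Sum>N=1..M. (osc_sum r L N)\<^sup>2)
       - real M / 8 * (\<Sum>m=1..L. r ^ (2 * m) / ((real m)\<^sup>2 * (s m)\<^sup>2))
       = (\<Sum>m=1..L. \<Sum>m'=1..L. H m m') / 4"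
      by (simp add: field_simps)
    have "\<bar>\<Sum>m=1..L. \<Sum>m'=1..L. H m m'\<bar> \<le> (\<Sum>m=1..L. \<Sum>m'=1..L. \<bar>H m m'\<bar>)"
      by (rule order.trans[OF sum_abs]) (intro sum_mono sum_abs)
    also have "\<dots> \<le> (\<Sum>m=1..L. \<Sum>m'=1..L. G m m' + G m' m)"
    proof (intro sum_mono)
      fix m m' assume "m \<in> {1..L}" "m' \<in> {1..L}"
      thus "\<bar>H m m'\<bar> \<le> G m m' + G m' m"
        using H_le[of m m'] H_le[of m' m] H_sym[of m m'] G0[of m m'] G0[of m' m]
        by (cases "m \<le> m'") auto
    qed
    also have "\<dots> = (\<Sum>m=1..L. \<Sum>m'=1..L. G m m') + (\<Sum>m=1..L. \<Sum>m'=1..L. G m' m)"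
      by (simp only: sum.distrib)
    also have "(\<Sum>m=1..L. \<Sum>m'=1..L. G m' m) = (\<Sum>m=1..L. \<Sum>m'=1..L. G m m')" by (rule sum.swap)
    also have "(\<Sum>m=1..L. \<Sum>m'=1..L. G m m') + (\<Sum>m=1..L. \<Sum>m'=1..L. G m m') \<le> 12 * E\<^sup>2"
      using G_sum by simp
    also have "\<dots> \<le> 12 * (C * sqrt (real M))\<^sup>2"
      using E E0 by (intro mult_left_mono power_mono) auto
    also have "\<dots> = 12 * C\<^sup>2 * real M" by (simp add: power_mult_distrib)
    finally have "\<bar>(\<Sum>m=1..L. \<Sum>m'=1..L. H m m') / 4\<bar> \<le> 3 * C\<^sup>2 * real M" by simp
    thus "\<bar>(\<Sum>N=1..M. (osc_sum (1 - 1 / real M) L N)\<^sup>2)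
       - real M / 8 * (\<Sum>m=1..L. (1 - 1 / real M) ^ (2 * m) / ((real m)\<^sup>2 * (s m)\<^sup>2))\<bar> \<le> 3 * C\<^sup>2 * real M"
      unfolding r_def[symmetric] eq .
  qed (use C in simp)
qed

text \<open>
For \<open>m \<le> M\<close> the smoothing weight differs from \<open>1\<close> by at most \<open>2 m / M\<close>, and for \<open>m > M\<close> one factor
\<open>1 / m\<close> is at most \<open>1 / M\<close>.  Both reduce the claim to sums of \<open>1 / (m * (s m)\<^sup>2)\<close> of order \<open>M\<close>.
\<close>
lemma smoothed_diagonal:
  "\<exists>C>0. \<forall>M L. M \<ge> 2 \<longrightarrow> L \<ge> M \<longrightarrow>
     \<bar>(\<Sum>m=1..L. (1 - 1 / real M) ^ (2 * m) / ((real m)\<^sup>2 * (s m)\<^sup>2))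
       - (\<Sum>m=1..M. 1 / ((real m)\<^sup>2 * (s m)\<^sup>2))\<bar> \<le> C"
proof -
  obtain C where C: "C > 0" "\<And>X. (\<Sum>m=1..X. 1 / (real m * (s m)\<^sup>2)) \<le> C * real X"
    "\<And>r L. 0 \<le> r \<Longrightarrow> r < 1 \<Longrightarrow> (\<Sum>m=1..L. r ^ m / (real m * (s m)\<^sup>2)) \<le> C / (1 - r)"
    by (rule exists_sum_constants) blast
  show ?thesis
  proof (intro exI[of _ "3 * C"] conjI allI impI)
    fix M L :: nat
    assume M: "M \<ge> 2" and L: "L \<ge> M"
    define r where "r = 1 - 1 / real M"
    have r: "0 \<le> r" "r < 1" "1 / (1 - r) = real M" using M by (auto simp: r_def)
    define w where "w m = 1 / ((real m)\<^sup>2 * (s m)\<^sup>2)" for m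
    define v where "v m = 1 / (real m * (s m)\<^sup>2)" for m
    have w0: "0 \<le> w m" "0 \<le> v m" for m by (simp_all add: w_def v_def)
    have wv: "real m * w m = v m" for m by (simp add: w_def v_def power2_eq_square)
    have "(\<Sum>m=1..L. r ^ (2 * m) * w m) = (\<Sum>m=1..M. r ^ (2 * m) * w m) + (\<Sum>m=Suc M..L. r ^ (2 * m) * w m)"
    proof -
      have "{1..L} = {1..M} \<union> {Suc M..L}" using L M by auto
      thus ?thesis by (simp add: sum.union_disjoint)
    qed
    hence eq: "(\<Sum>m=1..L. r ^ (2 * m) * w m) - (\<Sum>m=1..M. w m)
        = (\<Sum>m=Suc M..L. r ^ (2 * m) * w m) - (\<Sum>m=1..M. (1 - r ^ (2 * m)) * w m)"
      by (simp add: left_diff_distrib sum_subtractf)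
    have 1: "(\<Sum>m=1..M. (1 - r ^ (2 * m)) * w m) \<le> 2 * C"
    proof -
      have "(\<Sum>m=1..M. (1 - r ^ (2 * m)) * w m) \<le> (\<Sum>m=1..M. 2 / real M * v m)"
      proof (intro sum_mono)
        fix m
        have "1 - real (2 * m) * (1 - r) \<le> r ^ (2 * m)"
          using Bernoulli_inequality[of "r - 1" "2 * m"] r by (simp add: algebra_simps)
        hence "(1 - r ^ (2 * m)) * w m \<le> (real (2 * m) * (1 - r)) * w m"
          using w0 by (intro mult_right_mono) auto
        also have "\<dots> = 2 / real M * v m" by (simp add: r_def wv[symmetric])
        finally show "(1 - r ^ (2 * m)) * w m \<le> 2 / real M * v m" .
      qed
      also have "\<dots> = 2 / real M * (\<Sum>m=1..M. v m)" by (simp only: sum_distrib_left)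
      also have "\<dots> \<le> 2 / real M * (C * real M)"
        unfolding v_def by (intro mult_left_mono C(2)) auto
      finally show ?thesis using M by simp
    qed
    have 2: "(\<Sum>m=Suc M..L. r ^ (2 * m) * w m) \<le> C"
    proof -
      have "(\<Sum>m=Suc M..L. r ^ (2 * m) * w m) \<le> (\<Sum>m=Suc M..L. 1 / real M * (r ^ m * v m))"
      proof (intro sum_mono)
        fix m assume m: "m \<in> {Suc M..L}"
        have "r ^ (2 * m) * w m \<le> r ^ m * w m"
          using r w0 by (intro mult_right_mono power_decreasing) auto
        also have "w m \<le> 1 / real M * v m"
          using m M w0[of m] unfolding wv[symmetric] by (simp add: field_simps mult_right_mono)
        hence "r ^ m * w m \<le> r ^ m * (1 / real M * v m)"
          using r by (intro mult_left_mono) auto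
        finally show "r ^ (2 * m) * w m \<le> 1 / real M * (r ^ m * v m)"
          by (simp only: mult.left_commute)
      qed
      also have "\<dots> \<le> (\<Sum>m=1..L. 1 / real M * (r ^ m * v m))"
        using r w0 by (intro sum_mono2) auto
      also have "\<dots> = 1 / real M * (\<Sum>m=1..L. r ^ m / (real m * (s m)\<^sup>2))"
        by (simp add: sum_distrib_left v_def)
      also have "\<dots> \<le> 1 / real M * (C / (1 - r))"
        using r by (intro mult_left_mono C(3)) auto
      also have "C / (1 - r) = C * real M" using r(3) by (simp add: divide_inverse)
      finally show ?thesis using M by simp
    qed
    have 3: "0 \<le> (\<Sum>m=1..M. (1 - r ^ (2 * m)) * w m)" "0 \<le> (\<Sum>m=Suc M..L. r ^ (2 * m) * w m)"
      using r w0 by (auto intro!: sum_nonneg mult_nonneg_nonneg power_le_one)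
    have "\<bar>(\<Sum>m=1..L. r ^ (2 * m) * w m) - (\<Sum>m=1..M. w m)\<bar> \<le> 3 * C"
      unfolding eq using 1 2 3 C(1) by linarith
    thus "\<bar>(\<Sum>m=1..L. (1 - 1 / real M) ^ (2 * m) / ((real m)\<^sup>2 * (s m)\<^sup>2))
       - (\<Sum>m=1..M. 1 / ((real m)\<^sup>2 * (s m)\<^sup>2))\<bar> \<le> 3 * C"
      by (simp add: r_def w_def)
  qed (use C in simp)
qed

end

section \<open>The variance of Sudler products at badly approximable numbers\<close>

context badly_approximable
begin

lemma osc_sum_tendsto:
  fixes M N :: nat
  assumes M: "M \<ge> 2"
  defines "r \<equiv> 1 - 1 / real M"
  shows "(\<lambda>L. osc_sum r L N) \<longlonglongrightarrow>
    (\<Sum>n=1..N. ln ((1 - r)\<^sup>2 + 4 * r * (sin (pi * real n * \<alpha>))\<^sup>2) / 2) - ln (real M) / 2"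
proof -
  have r: "0 \<le> r" "r < 1" "1 - r = 1 / real M" using M by (auto simp: r_def)
  have lim: "(\<lambda>L. \<Sum>m=1..L. r ^ m / real m * cos (2 * real m * x)) \<longlonglongrightarrow>
      - ln ((1 - r)\<^sup>2 + 4 * r * (sin x)\<^sup>2) / 2" for x
  proof -
    have "(\<Sum>m<Suc L. r ^ m / real m * cos (2 * real m * x))
        = (\<Sum>m=1..L. r ^ m / real m * cos (2 * real m * x))" for L
    proof -
      have "{..<Suc L} = insert 0 {1..L}" by auto
      thus ?thesis by simp
    qed
    thus ?thesis
      using LIMSEQ_Suc[OF log_Abel_series[OF r(1,2), of x, unfolded sums_def]] by (simp only:)
  qed
  have eq: "osc_sum r L N = - (\<Sum>n=1..N. \<Sum>m=1..L. r ^ m / real m * cos (2 * real m * (pi * real n * \<alpha>)))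
      - (\<Sum>m=1..L. r ^ m / real m * cos (2 * real m * 0)) / 2" for L
  proof -
    have "r ^ m / real m * (sin ((2 * real N + 1) * (pi * real m * \<alpha>)) / (2 * sin (pi * real m * \<alpha>)))
        = (\<Sum>n=1..N. r ^ m / real m * cos (2 * real m * (pi * real n * \<alpha>)))
          + r ^ m / real m * cos (2 * real m * 0) / 2" if "m \<in> {1..L}" for m
    proof -
      have nz: "sin (pi * real m * \<alpha>) \<noteq> 0" using that by (intro sin_nonzero) auto
      have "sin ((2 * real N + 1) * (pi * real m * \<alpha>)) / (2 * sin (pi * real m * \<alpha>))
          = (\<Sum>n=1..N. cos (2 * real n * (pi * real m * \<alpha>))) + 1 / 2"
        using sum_cos_even[OF nz, of N] by linarith
      also have "(\<Sum>n=1..N. cos (2 * real n * (pi * real m * \<alpha>)))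
          = (\<Sum>n=1..N. cos (2 * real m * (pi * real n * \<alpha>)))"
        by (intro sum.cong refl arg_cong[where f = cos]) simp
      finally show ?thesis
        by (simp only: distrib_left sum_distrib_left) simp
    qed
    hence "osc_sum r L N = - (\<Sum>m=1..L. (\<Sum>n=1..N. r ^ m / real m * cos (2 * real m * (pi * real n * \<alpha>)))
          + r ^ m / real m * cos (2 * real m * 0) / 2)"
      unfolding osc_sum_def by (intro arg_cong[where f = uminus] sum.cong) auto
    also have "\<dots> = - (\<Sum>m=1..L. \<Sum>n=1..N. r ^ m / real m * cos (2 * real m * (pi * real n * \<alpha>)))
      - (\<Sum>m=1..L. r ^ m / real m * cos (2 * real m * 0)) / 2"
      by (simp only: sum.distrib sum_divide_distrib minus_add_distrib diff_conv_add_uminus)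
    also have "(\<Sum>m=1..L. \<Sum>n=1..N. r ^ m / real m * cos (2 * real m * (pi * real n * \<alpha>)))
       = (\<Sum>n=1..N. \<Sum>m=1..L. r ^ m / real m * cos (2 * real m * (pi * real n * \<alpha>)))"
      by (rule sum.swap)
    finally show ?thesis .
  qed
  have l1: "ln ((1 - r)\<^sup>2 + 4 * r * (sin 0)\<^sup>2) = - 2 * ln (real M)"
  proof -
    have "ln ((1 - r)\<^sup>2 + 4 * r * (sin 0)\<^sup>2) = ln ((1 / real M) ^ 2)" by (simp add: r)
    also have "\<dots> = 2 * ln (1 / real M)" using M by (subst ln_realpow) auto
    finally show ?thesis using M by (simp add: ln_div)
  qed
  have "(\<lambda>L. osc_sum r L N) \<longlonglongrightarrow>
     - (\<Sum>n=1..N. - ln ((1 - r)\<^sup>2 + 4 * r * (sin (pi * real n * \<alpha>))\<^sup>2) / 2)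
     - (- ln ((1 - r)\<^sup>2 + 4 * r * (sin 0)\<^sup>2) / 2) / 2"
    unfolding eq by (intro tendsto_intros lim) simp
  moreover have "- (\<Sum>n=1..N. - ln ((1 - r)\<^sup>2 + 4 * r * (sin (pi * real n * \<alpha>))\<^sup>2) / 2)
     - (- ln ((1 - r)\<^sup>2 + 4 * r * (sin 0)\<^sup>2) / 2) / 2
     = (\<Sum>n=1..N. ln ((1 - r)\<^sup>2 + 4 * r * (sin (pi * real n * \<alpha>))\<^sup>2) / 2) - ln (real M) / 2"
    unfolding l1 by (simp add: sum_negf)
  ultimately show ?thesis by (simp only:)
qed

text \<open>
Here \<open>a\<close> is the limit of the truncated oscillating sums and \<open>g\<close> collects the smoothing errors \<open>e\<close>.
The cross term is rearranged into \<open>\<Sum>n. e n * (\<Sum>N=n..M. a N)\<close>, so that cancellation in the sums of \<open>a\<close>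
is used against the absolute convergence of \<open>\<Sum>n. e n\<close>.
\<close>
lemma sudler_variance:
  "\<exists>C. \<forall>M\<ge>2. \<bar>1 / real M * (\<Sum>N=1..M. (ln (sudler_product N \<alpha>) - 1 / 2 * ln (real M))\<^sup>2)
     - 1 / 8 * (\<Sum>m=1..M. 1 / ((real m)\<^sup>2 * (s m)\<^sup>2))\<bar> \<le> C"
proof -
  obtain C0 where C0: "C0 > 0" "\<And>X. (\<Sum>m=1..X. 1 / (real m * (s m)\<^sup>2)) \<le> C0 * real X"
    by (rule exists_sum_constants) blast
  obtain C1 where C1: "C1 > 0" "\<And>M L n. M \<ge> 2 \<Longrightarrow> n \<le> Suc M \<Longrightarrow>
     \<bar>\<Sum>N=n..M. osc_sum (1 - 1 / real M) L N\<bar> \<le> C1 * real M"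
    using osc_sum_tail_le by blast
  obtain C2 where C2: "C2 > 0" "\<And>M L. M \<ge> 2 \<Longrightarrow>
     \<bar>(\<Sum>N=1..M. (osc_sum (1 - 1 / real M) L N)\<^sup>2)
       - real M / 8 * (\<Sum>m=1..L. (1 - 1 / real M) ^ (2 * m) / ((real m)\<^sup>2 * (s m)\<^sup>2))\<bar> \<le> C2 * real M"
    using osc_sum_second_moment by blast
  obtain C3 where C3: "C3 > 0" "\<And>M L. M \<ge> 2 \<Longrightarrow> L \<ge> M \<Longrightarrow>
     \<bar>(\<Sum>m=1..L. (1 - 1 / real M) ^ (2 * m) / ((real m)\<^sup>2 * (s m)\<^sup>2))
       - (\<Sum>m=1..M. 1 / ((real m)\<^sup>2 * (s m)\<^sup>2))\<bar> \<le> C3"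
    using smoothed_diagonal by blast
  define C4 where "C4 = C0 + 1"
  have C4: "C4 > 0" using C0 by (simp add: C4_def)
  show ?thesis
  proof (intro exI[of _ "C2 + C3 / 8 + 2 * (C4 * C1) + C4\<^sup>2"] allI impI)
    fix M :: nat
    assume M: "M \<ge> 2"
    define r where "r = 1 - 1 / real M"
    define e where "e n = ln \<bar>2 * sin (pi * real n * \<alpha>)\<bar>
      - ln ((1 - r)\<^sup>2 + 4 * r * (sin (pi * real n * \<alpha>))\<^sup>2) / 2" for n
    define g where "g N = (\<Sum>n=1..N. e n)" for N
    define a where "a N = (\<Sum>n=1..N. ln ((1 - r)\<^sup>2 + 4 * r * (sin (pi * real n * \<alpha>))\<^sup>2) / 2)
      - ln (real M) / 2" for N
    define U where "U = (\<Sum>m=1..M. 1 / ((real m)\<^sup>2 * (s m)\<^sup>2))"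
    have lim: "(\<lambda>L. osc_sum r L N) \<longlonglongrightarrow> a N" for N
      unfolding a_def r_def using osc_sum_tendsto[OF M] .
    have ag: "ln (sudler_product N \<alpha>) - 1 / 2 * ln (real M) = a N + g N" for N
    proof -
      have "ln (sudler_product N \<alpha>) = (\<Sum>n=1..N. ln \<bar>2 * sin (pi * real n * \<alpha>)\<bar>)"
        unfolding sudler_product_def by (rule ln_prod) (use sin_nonzero in auto)
      thus ?thesis by (simp add: a_def g_def e_def sum_subtractf)
    qed
    have e_sum: "(\<Sum>n=1..M. \<bar>e n\<bar>) \<le> C4"
    proof -
      have "(\<Sum>n=1..M. \<bar>e n\<bar>) \<le> (\<Sum>n=1..M. 1 / real M * (1 / (real n * (s n)\<^sup>2)) + 1 / real M)"
      proof (intro sum_mono)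
        fix n assume n: "n \<in> {1..M}"
        have "\<bar>e n\<bar> \<le> 1 / ((real M)\<^sup>2 * (s n)\<^sup>2) + 1 / real M"
          using log_two_sin_approx[OF M sin_nonzero, of n] n by (simp add: e_def r_def s_def)
        also have "1 / ((real M)\<^sup>2 * (s n)\<^sup>2) \<le> 1 / (real M * real n * (s n)\<^sup>2)"
          using n s_pos[of n] by (intro divide_left_mono mult_right_mono) (auto simp: power2_eq_square)
        also have "1 / (real M * real n * (s n)\<^sup>2) = 1 / real M * (1 / (real n * (s n)\<^sup>2))" by simp
        finally show "\<bar>e n\<bar> \<le> 1 / real M * (1 / (real n * (s n)\<^sup>2)) + 1 / real M" by simp
      qed
      also have "\<dots> = 1 / real M * (\<Sum>n=1..M. 1 / (real n * (s n)\<^sup>2)) + real M * (1 / real M)"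
        by (simp only: sum.distrib sum_distrib_left) simp
      also have "\<dots> \<le> 1 / real M * (C0 * real M) + real M * (1 / real M)"
        by (intro add_mono mult_left_mono C0(2)) auto
      also have "\<dots> = C4" using M by (simp add: C4_def)
      finally show ?thesis .
    qed
    have g_le: "\<bar>g N\<bar> \<le> C4" if "N \<in> {1..M}" for N
    proof -
      have "\<bar>g N\<bar> \<le> (\<Sum>n=1..N. \<bar>e n\<bar>)" unfolding g_def by (rule sum_abs)
      also have "\<dots> \<le> (\<Sum>n=1..M. \<bar>e n\<bar>)" using that by (intro sum_mono2) auto
      finally show ?thesis using e_sum by simp
    qed
    have tail: "\<bar>\<Sum>N=n..M. a N\<bar> \<le> C1 * real M" if "n \<le> Suc M" for n
    proof (rule tendsto_upperbound)
      show "(\<lambda>L. \<bar>\<Sum>N=n..M. osc_sum r L N\<bar>) \<longlonglongrightarrow> \<bar>\<Sum>N=n..M. a N\<bar>"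
        by (intro tendsto_intros lim)
      show "\<forall>\<^sub>F L in sequentially. \<bar>\<Sum>N=n..M. osc_sum r L N\<bar> \<le> C1 * real M"
        unfolding r_def using C1(2)[OF M that] by simp
    qed simp
    have sq: "\<bar>(\<Sum>N=1..M. (a N)\<^sup>2) - real M / 8 * U\<bar> \<le> (C2 + C3 / 8) * real M"
    proof (rule tendsto_upperbound)
      show "(\<lambda>L. \<bar>(\<Sum>N=1..M. (osc_sum r L N)\<^sup>2) - real M / 8 * U\<bar>) \<longlonglongrightarrow> \<bar>(\<Sum>N=1..M. (a N)\<^sup>2) - real M / 8 * U\<bar>"
        by (intro tendsto_intros lim)
      show "\<forall>\<^sub>F L in sequentially. \<bar>(\<Sum>N=1..M. (osc_sum r L N)\<^sup>2) - real M / 8 * U\<bar> \<le> (C2 + C3 / 8) * real M"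
        using eventually_ge_at_top[of M]
      proof eventually_elim
        case (elim L)
        define D where "D = (\<Sum>m=1..L. r ^ (2 * m) / ((real m)\<^sup>2 * (s m)\<^sup>2))"
        have "\<bar>(\<Sum>N=1..M. (osc_sum r L N)\<^sup>2) - real M / 8 * D\<bar> \<le> C2 * real M"
          using C2(2)[OF M, of L] by (simp only: r_def D_def)
        moreover have "\<bar>D - U\<bar> \<le> C3"
          using C3(2)[OF M elim] by (simp only: r_def D_def U_def)
        hence "real M / 8 * \<bar>D - U\<bar> \<le> real M / 8 * C3" by (intro mult_left_mono) auto
        moreover have "real M / 8 * D - real M / 8 * U = real M / 8 * (D - U)"
          by (simp only: right_diff_distrib)
        hence "\<bar>real M / 8 * D - real M / 8 * U\<bar> = real M / 8 * \<bar>D - U\<bar>"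
          by (simp only: abs_mult abs_divide abs_of_nat abs_numeral)
        moreover have "real M / 8 * C3 = C3 / 8 * real M" by simp
        ultimately show ?case unfolding distrib_right by linarith
      qed
    qed simp
    have cross: "\<bar>\<Sum>N=1..M. a N * g N\<bar> \<le> C4 * C1 * real M"
    proof -
      have "(\<Sum>N=1..M. a N * g N) = (\<Sum>N\<in>{1..M}. \<Sum>n\<in>{n\<in>{1..M}. n \<le> N}. a N * e n)"
        unfolding g_def sum_distrib_left by (intro sum.cong refl) auto
      also have "\<dots> = (\<Sum>n\<in>{1..M}. \<Sum>N\<in>{N\<in>{1..M}. n \<le> N}. a N * e n)"
        by (rule sum.swap_restrict) auto
      also have "\<dots> = (\<Sum>n=1..M. e n * (\<Sum>N=n..M. a N))"
        unfolding sum_distrib_left by (intro sum.cong) auto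
      also have "\<bar>\<dots>\<bar> \<le> (\<Sum>n=1..M. \<bar>e n\<bar> * (C1 * real M))"
      proof (rule order.trans[OF sum_abs], rule sum_mono)
        fix n assume "n \<in> {1..M}"
        thus "\<bar>e n * (\<Sum>N=n..M. a N)\<bar> \<le> \<bar>e n\<bar> * (C1 * real M)"
          unfolding abs_mult using tail[of n] by (intro mult_left_mono) auto
      qed
      also have "\<dots> = (\<Sum>n=1..M. \<bar>e n\<bar>) * (C1 * real M)" by (simp only: sum_distrib_right)
      also have "\<dots> \<le> C4 * (C1 * real M)" using C1 e_sum by (intro mult_right_mono) auto
      finally show ?thesis by simp
    qed
    have g2: "\<bar>\<Sum>N=1..M. (g N)\<^sup>2\<bar> \<le> C4\<^sup>2 * real M"
    proof -
      have "\<bar>\<Sum>N=1..M. (g N)\<^sup>2\<bar> \<le> (\<Sum>N=1..M. C4\<^sup>2)"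
      proof (rule order.trans[OF sum_abs], rule sum_mono)
        fix N assume "N \<in> {1..M}"
        hence "\<bar>g N\<bar>\<^sup>2 \<le> C4\<^sup>2" using g_le by (intro power_mono) auto
        thus "\<bar>(g N)\<^sup>2\<bar> \<le> C4\<^sup>2" by simp
      qed
      thus ?thesis by (simp add: mult.commute)
    qed
    have split: "(\<Sum>N=1..M. (a N + g N)\<^sup>2)
        = (\<Sum>N=1..M. (a N)\<^sup>2) + 2 * (\<Sum>N=1..M. a N * g N) + (\<Sum>N=1..M. (g N)\<^sup>2)"
      by (simp add: power2_sum sum.distrib sum_distrib_left mult.assoc)
    have "\<bar>(\<Sum>N=1..M. (a N + g N)\<^sup>2) - real M / 8 * U\<bar>
        \<le> (C2 + C3 / 8) * real M + 2 * (C4 * C1 * real M) + C4\<^sup>2 * real M"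
      unfolding split using sq cross g2 by linarith
    also have "\<dots> = real M * (C2 + C3 / 8 + 2 * (C4 * C1) + C4\<^sup>2)"
      by (simp add: algebra_simps)
    finally have "\<bar>(\<Sum>N=1..M. (a N + g N)\<^sup>2) - real M / 8 * U\<bar> / real M
        \<le> C2 + C3 / 8 + 2 * (C4 * C1) + C4\<^sup>2"
      using M by (simp add: divide_le_eq mult.commute)
    moreover have "1 / real M * (\<Sum>N=1..M. (a N + g N)\<^sup>2) - 1 / 8 * U
        = ((\<Sum>N=1..M. (a N + g N)\<^sup>2) - real M / 8 * U) / real M"
      using M by (simp add: diff_divide_distrib)
    ultimately show "\<bar>1 / real M * (\<Sum>N=1..M. (ln (sudler_product N \<alpha>) - 1 / 2 * ln (real M))\<^sup>2)
      - 1 / 8 * (\<Sum>m=1..M. 1 / ((real m)\<^sup>2 * (s m)\<^sup>2))\<bar>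
      \<le> C2 + C3 / 8 + 2 * (C4 * C1) + C4\<^sup>2"
      unfolding ag U_def by simp
  qed
qed

end

section \<open>Quadratic irrationals and units\<close>

text \<open>
The two roots of the polynomial \<open>a x\<^sup>2 + b x + d\<close>, through their elementary symmetric functions.
\<close>
locale conjugate_pair =
  fixes \<alpha> \<beta> :: real and a b d :: int
  assumes irrational: "\<alpha> \<notin> \<rat>" and a_nonzero: "a \<noteq> 0"
    and vieta_sum: "of_int a * (\<alpha> + \<beta>) = - of_int b"
    and vieta_prod: "of_int a * (\<alpha> * \<beta>) = of_int d"
begin

lemma beta_irrational: "\<beta> \<notin> \<rat>"
proof
  assume "\<beta> \<in> \<rat>"
  moreover have "\<alpha> = - of_int b / of_int a - \<beta>"
    using vieta_sum a_nonzero by (simp add: field_simps)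
  ultimately have "\<alpha> \<in> \<rat>" by simp
  thus False using irrational by simp
qed

lemma int_combination_nonzero:
  assumes "x \<notin> \<rat>" "m \<noteq> 0 \<or> n \<noteq> 0"
  shows "of_int m * x - of_int n \<noteq> (0 :: real)"
proof
  assume *: "of_int m * x - of_int n = 0"
  show False
  proof (cases "m = 0")
    case True
    thus False using * assms(2) by simp
  next
    case False
    hence "x = of_int n / of_int m" using * by (simp add: field_simps)
    thus False using assms(1) by simp
  qed
qed

definition \<delta> :: real where "\<delta> = \<alpha> - \<beta>"

lemma \<delta>_nonzero: "\<delta> \<noteq> 0"
proof
  assume "\<delta> = 0"
  hence "of_int (2 * a) * \<alpha> - of_int (- b) = 0" using vieta_sum by (simp add: \<delta>_def algebra_simps)
  thus False using int_combination_nonzero[OF irrational, of "2 * a" "- b"] a_nonzero by simp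
qed

text \<open>
The norm form \<open>d m\<^sup>2 + b m n + a n\<^sup>2\<close> takes nonzero integer values.
\<close>
lemma norm_form_ge:
  assumes "m \<noteq> 0 \<or> n \<noteq> 0"
  shows "1 \<le> \<bar>of_int a * ((of_int m * \<alpha> - of_int n) * (of_int m * \<beta> - of_int n))\<bar>"
proof -
  have "of_int a * ((of_int m * \<alpha> - of_int n) * (of_int m * \<beta> - of_int n))
      = of_int m ^ 2 * (of_int a * (\<alpha> * \<beta>)) - of_int m * of_int n * (of_int a * (\<alpha> + \<beta>)) + of_int a * of_int n ^ 2"
    by algebra
  also have "\<dots> = of_int (m ^ 2 * d + m * n * b + a * n ^ 2)"
    unfolding vieta_sum vieta_prod by simp
  finally have eq: "of_int a * ((of_int m * \<alpha> - of_int n) * (of_int m * \<beta> - of_int n))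
      = of_int (m ^ 2 * d + m * n * b + a * n ^ 2)" .
  have "of_int a * ((of_int m * \<alpha> - of_int n) * (of_int m * \<beta> - of_int n)) \<noteq> 0"
    using int_combination_nonzero[OF irrational assms] int_combination_nonzero[OF beta_irrational assms] a_nonzero
    by simp
  hence "m ^ 2 * d + m * n * b + a * n ^ 2 \<noteq> 0" unfolding eq of_int_eq_0_iff .
  thus ?thesis unfolding eq by linarith
qed

lemma badly_approximable: "badly_approximable \<alpha> (1 / (of_int \<bar>a\<bar> * (1 + \<bar>\<delta>\<bar>)))"
proof
  have pos: "0 < real_of_int \<bar>a\<bar> * (1 + \<bar>\<delta>\<bar>)" using a_nonzero by (intro mult_pos_pos) auto
  thus "0 < 1 / (of_int \<bar>a\<bar> * (1 + \<bar>\<delta>\<bar>))" by simp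
  fix m :: nat and n :: int
  assume m: "0 < m"
  have a1: "1 \<le> real_of_int \<bar>a\<bar>" using a_nonzero by linarith
  show "1 / (of_int \<bar>a\<bar> * (1 + \<bar>\<delta>\<bar>)) \<le> real m * \<bar>real m * \<alpha> - of_int n\<bar>"
  proof (cases "\<bar>real m * \<alpha> - of_int n\<bar> \<ge> 1")
    case True
    have "1 * 1 \<le> real_of_int \<bar>a\<bar> * (1 + \<bar>\<delta>\<bar>)" using a1 by (intro mult_mono) auto
    hence "1 / (of_int \<bar>a\<bar> * (1 + \<bar>\<delta>\<bar>)) \<le> 1" using pos by simp
    also have "1 \<le> real m * \<bar>real m * \<alpha> - of_int n\<bar>"
      using mult_mono[of 1 "real m" 1 "\<bar>real m * \<alpha> - of_int n\<bar>"] True m by simp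
    finally show ?thesis .
  next
    case False
    define x where "x = \<bar>real m * \<alpha> - of_int n\<bar>"
    have "\<bar>real m * \<beta> - of_int n\<bar> \<le> x + \<bar>real m * \<delta>\<bar>"
      unfolding x_def \<delta>_def right_diff_distrib by linarith
    also have "\<dots> \<le> real m * 1 + real m * \<bar>\<delta>\<bar>"
      using False m by (simp add: x_def abs_mult)
    finally have beta: "\<bar>real m * \<beta> - of_int n\<bar> \<le> real m * (1 + \<bar>\<delta>\<bar>)" by (simp add: distrib_left)
    have "1 \<le> of_int \<bar>a\<bar> * (x * \<bar>real m * \<beta> - of_int n\<bar>)"
      using norm_form_ge[of "int m" n] m by (simp add: abs_mult x_def)
    also have "\<dots> \<le> of_int \<bar>a\<bar> * (x * (real m * (1 + \<bar>\<delta>\<bar>)))"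
      using beta a1 by (intro mult_left_mono) (auto simp: x_def)
    finally show ?thesis using pos unfolding x_def[symmetric] by (simp add: divide_le_eq mult_ac)
  qed
qed

text \<open>
Existence of a nontrivial solution of the Pell-type equation in the order \<open>\<int>[\<omega>]\<close>, \<open>\<omega> = a \<alpha>\<close>.  Dirichlet's
theorem gives elements \<open>z\<^sub>n = t\<^sub>n + u\<^sub>n \<omega>\<close> of bounded norm with \<open>\<bar>z\<^sub>n\<bar> < 1 / (n + 1)\<close>.  Infinitely many share the same
norm \<open>k\<close> and the same residues modulo \<open>k\<close>; a quotient of two of these is again in the order, has
norm one, and is as small as desired.
\<close>
lemma exists_small_unit:
  obtains t u :: int where "t\<^sup>2 - b * t * u + a * d * u\<^sup>2 = 1"
    and "0 < of_int t + of_int u * (of_int a * \<alpha>)" "of_int t + of_int u * (of_int a * \<alpha>) < 1 / 2"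
proof -
  define \<omega> \<omega>' where "\<omega> = of_int a * \<alpha>" and "\<omega>' = of_int a * \<beta>"
  have sum: "\<omega>' = - of_int b - \<omega>" using vieta_sum by (simp add: \<omega>_def \<omega>'_def algebra_simps)
  have prod: "\<omega> * \<omega>' = of_int (a * d)"
    using vieta_prod by (simp add: \<omega>_def \<omega>'_def mult_ac)
  define N where "N t u = t\<^sup>2 - b * t * u + a * d * u\<^sup>2" for t u :: int
  have N: "real_of_int (N t u) = (of_int t + of_int u * \<omega>) * (of_int t + of_int u * \<omega>')" for t u
  proof -
    have "(of_int t + of_int u * \<omega>) * (of_int t + of_int u * \<omega>')
        = of_int t ^ 2 + of_int t * of_int u * (\<omega> + \<omega>') + of_int u ^ 2 * (\<omega> * \<omega>')"
      by algebra
    also have "\<omega> + \<omega>' = - of_int b" using sum by simp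
    finally show ?thesis unfolding prod by (simp add: N_def algebra_simps)
  qed
  have \<omega>_irr: "\<omega> \<notin> \<rat>" "\<omega>' \<notin> \<rat>"
  proof -
    show "\<omega> \<notin> \<rat>"
    proof
      assume "\<omega> \<in> \<rat>"
      hence "\<omega> / of_int a \<in> \<rat>" by simp
      thus False using irrational a_nonzero by (simp add: \<omega>_def)
    qed
    show "\<omega>' \<notin> \<rat>"
    proof
      assume "\<omega>' \<in> \<rat>"
      hence "\<omega>' / of_int a \<in> \<rat>" by simp
      thus False using beta_irrational a_nonzero by (simp add: \<omega>'_def)
    qed
  qed
  have "\<forall>n::nat. \<exists>t u::int. 0 < u \<and> u \<le> int (Suc n) \<and> \<bar>of_int t + of_int u * \<omega>\<bar> < 1 / real (Suc n)"
  proof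
    fix n :: nat
    obtain h k where hk: "0 < k" "k \<le> int (Suc n)" "\<bar>of_int k * \<omega> - of_int h\<bar> < 1 / real (Suc n)"
      by (rule Dirichlet_approx[of "Suc n" \<omega>]) auto
    thus "\<exists>t u::int. 0 < u \<and> u \<le> int (Suc n) \<and> \<bar>of_int t + of_int u * \<omega>\<bar> < 1 / real (Suc n)"
      by (intro exI[of _ "- h"] exI[of _ k]) auto
  qed
  then obtain t u :: "nat \<Rightarrow> int" where tu: "\<And>n. 0 < u n" "\<And>n. u n \<le> int (Suc n)"
      "\<And>n. \<bar>of_int (t n) + of_int (u n) * \<omega>\<bar> < 1 / real (Suc n)"
    by metis
  define z where "z n = of_int (t n) + of_int (u n) * \<omega>" for n
  define z' where "z' n = of_int (t n) + of_int (u n) * \<omega>'" for n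
  have z0: "z n \<noteq> 0" "z' n \<noteq> 0" for n
    using int_combination_nonzero[OF \<omega>_irr(1), of "u n" "- t n"] int_combination_nonzero[OF \<omega>_irr(2), of "u n" "- t n"]
      tu(1)[of n] by (auto simp: z_def z'_def add.commute)
  define k where "k n = N (t n) (u n)" for n
  have kz: "real_of_int (k n) = z n * z' n" for n by (simp add: k_def N z_def z'_def)
  define B where "B = \<lceil>1 + \<bar>\<omega> - \<omega>'\<bar>\<rceil>"
  have k_bound: "\<bar>k n\<bar> \<le> B" for n
  proof -
    have zl: "\<bar>z n\<bar> \<le> 1 / real (Suc n)" using tu(3)[of n] by (simp add: z_def)
    have "1 / real (Suc n) \<le> 1" by simp
    have "\<bar>z' n\<bar> = \<bar>z n - of_int (u n) * (\<omega> - \<omega>')\<bar>" by (simp add: z_def z'_def algebra_simps)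
    also have "\<dots> \<le> \<bar>z n\<bar> + of_int (u n) * \<bar>\<omega> - \<omega>'\<bar>"
      using tu(1)[of n] by (intro order.trans[OF abs_triangle_ineq4]) (simp add: abs_mult)
    also have "\<dots> \<le> real (Suc n) * 1 + real (Suc n) * \<bar>\<omega> - \<omega>'\<bar>"
    proof (intro add_mono mult_right_mono)
      have "1 \<le> real (Suc n)" by simp
      thus "\<bar>z n\<bar> \<le> real (Suc n) * 1"
        using order.trans[OF zl \<open>1 / real (Suc n) \<le> 1\<close>] by simp
      show "real_of_int (u n) \<le> real (Suc n)" using tu(2)[of n] by linarith
    qed auto
    finally have "\<bar>z' n\<bar> \<le> real (Suc n) * (1 + \<bar>\<omega> - \<omega>'\<bar>)" by (simp add: distrib_left)
    hence "\<bar>z n\<bar> * \<bar>z' n\<bar> \<le> 1 / real (Suc n) * (real (Suc n) * (1 + \<bar>\<omega> - \<omega>'\<bar>))"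
      using zl by (intro mult_mono) auto
    also have "\<dots> = 1 + \<bar>\<omega> - \<omega>'\<bar>" by simp
    finally have "\<bar>real_of_int (k n)\<bar> \<le> 1 + \<bar>\<omega> - \<omega>'\<bar>" by (simp add: kz abs_mult)
    thus ?thesis unfolding B_def by linarith
  qed
  have k0: "k n \<noteq> 0" for n using kz[of n] z0[of n] by auto
  define cls where "cls n = (k n, t n mod k n, u n mod k n)" for n
  have "range cls \<subseteq> {-B..B} \<times> {-B..B} \<times> {-B..B}"
  proof -
    have "\<bar>x mod k n\<bar> \<le> B" for x n
      using abs_mod_less[OF k0[of n], of x] k_bound[of n] by linarith
    thus ?thesis using k_bound by (auto simp: cls_def abs_le_iff minus_le_iff)
  qed
  hence "finite (range cls)" by (rule finite_subset) auto
  then obtain n2 where "\<not> finite {n \<in> UNIV. cls n = cls n2}"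
    using pigeonhole_infinite[OF infinite_UNIV_nat, of cls] by blast
  hence inf: "infinite {n. cls n = cls n2}" by simp
  obtain m where m: "2 / \<bar>z n2\<bar> < real m" using reals_Archimedean2 by blast
  obtain n1 where n1: "n1 \<ge> m" "cls n1 = cls n2"
    using inf unfolding infinite_nat_iff_unbounded_le by blast
  have kk: "k n1 = k n2" using n1 by (simp add: cls_def)
  obtain p where p: "t n1 = t n2 + k n2 * p"
    using n1(2) kk by (auto simp: cls_def mod_eq_dvd_iff dvd_def algebra_simps)
  obtain q where q: "u n1 = u n2 + k n2 * q"
    using n1(2) kk by (auto simp: cls_def mod_eq_dvd_iff dvd_def algebra_simps)
  \<comment> \<open>The quotient of the two elements: \<open>z n1 = z n2 + k n2 * (p + q * \<omega>)\<close> and \<open>k n2 = z n2 * z' n2\<close> give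
    \<open>z n1 / z n2 = 1 + z' n2 * (p + q * \<omega>)\<close>, which has the coordinates \<open>T\<close>, \<open>V\<close>.\<close>
  define T where "T = 1 + p * t n2 - b * p * u n2 + q * u n2 * (a * d)"
  define V where "V = q * t n2 - p * u n2"
  define \<mu> \<mu>' where "\<mu> = of_int T + of_int V * \<omega>" and "\<mu>' = of_int T + of_int V * \<omega>'"
  have mu: "\<mu> = 1 + z' n2 * (of_int p + of_int q * \<omega>)"
  proof -
    have "z' n2 * (of_int p + of_int q * \<omega>) = of_int (t n2) * of_int p + of_int (t n2) * of_int q * \<omega>
       + of_int (u n2) * of_int p * \<omega>' + of_int (u n2) * of_int q * (\<omega> * \<omega>')"
      unfolding z'_def by algebra
    thus ?thesis unfolding prod unfolding sum \<mu>_def T_def V_def by (simp add: algebra_simps)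
  qed
  have mu': "\<mu>' = 1 + z n2 * (of_int p + of_int q * \<omega>')"
  proof -
    have "z n2 * (of_int p + of_int q * \<omega>') = of_int (t n2) * of_int p + of_int (t n2) * of_int q * \<omega>'
       + of_int (u n2) * of_int p * \<omega> + of_int (u n2) * of_int q * (\<omega> * \<omega>')"
      unfolding z_def by algebra
    moreover have "\<omega> = - of_int b - \<omega>'" using sum by simp
    ultimately show ?thesis unfolding prod \<mu>'_def T_def V_def by (simp add: algebra_simps)
  qed
  have z1: "z n1 = z n2 + of_int (k n2) * (of_int p + of_int q * \<omega>)"
    unfolding z_def p q by (simp add: algebra_simps)
  have z1': "z' n1 = z' n2 + of_int (k n2) * (of_int p + of_int q * \<omega>')"
    unfolding z'_def p q by (simp add: algebra_simps)
  have e1: "z n1 = \<mu> * z n2" unfolding z1 kz mu by algebra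
  have e2: "z' n1 = \<mu>' * z' n2" unfolding z1' kz mu' by algebra
  have "z n2 * z' n2 = z n1 * z' n1" using kz[of n1] kz[of n2] kk by simp
  also have "\<dots> = (\<mu> * \<mu>') * (z n2 * z' n2)" unfolding e1 e2 by algebra
  finally have mm: "\<mu> * \<mu>' = 1" using z0[of n2] by simp
  have "real_of_int (N T V) = 1" unfolding N using mm by (simp add: \<mu>_def \<mu>'_def)
  hence NT: "N T V = 1" by linarith
  have mu0: "\<mu> \<noteq> 0" using mm by auto
  have mpos: "0 < real m"
  proof -
    have "0 < 2 / \<bar>z n2\<bar>" using z0[of n2] by simp
    thus ?thesis using m by linarith
  qed
  have "\<bar>z n1\<bar> < 1 / real (Suc n1)" using tu(3) by (simp add: z_def)
  also have "\<dots> \<le> 1 / real m" using n1(1) mpos by (intro frac_le) auto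
  also have "\<dots> \<le> \<bar>z n2\<bar> / 2"
  proof -
    have "2 < real m * \<bar>z n2\<bar>" using m z0[of n2] by (simp add: divide_less_eq)
    thus ?thesis using mpos by (simp add: field_simps)
  qed
  finally have "\<bar>\<mu>\<bar> * \<bar>z n2\<bar> < 1 / 2 * \<bar>z n2\<bar>" unfolding e1 abs_mult by simp
  hence small: "\<bar>\<mu>\<bar> < 1 / 2" using z0[of n2] by (simp add: mult_less_cancel_right)
  show thesis
  proof (cases "\<mu> > 0")
    case True
    show thesis
      by (rule that[of T V]) (use NT True small in \<open>auto simp: N_def \<mu>_def \<omega>_def\<close>)
  next
    case False
    have eq: "of_int (- T) + of_int (- V) * (of_int a * \<alpha>) = - \<mu>" by (simp add: \<mu>_def \<omega>_def)
    show thesis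
      by (rule that[of "- T" "- V"], unfold eq) (use NT False mu0 small in \<open>auto simp: N_def\<close>)
  qed
qed

end

section \<open>Logarithmic growth of the diagonal\<close>

context conjugate_pair
begin

definition near :: "int \<Rightarrow> int" where "near m = round (of_int m * \<alpha>)"
definition \<xi> :: "int \<Rightarrow> real" where "\<xi> m = of_int m * \<alpha> - of_int (near m)"
definition \<eta> :: "int \<Rightarrow> real" where "\<eta> m = of_int m * \<beta> - of_int (near m)"

lemma \<eta>_eq: "\<eta> m = \<xi> m - of_int m * \<delta>"
  by (simp add: \<eta>_def \<xi>_def \<delta>_def right_diff_distrib)

lemma \<xi>_less_half: "\<bar>\<xi> m\<bar> < 1 / 2"
proof -
  have le: "\<bar>\<xi> m\<bar> \<le> 1 / 2"
    using of_int_round_abs_le[of "of_int m * \<alpha>"] by (simp add: \<xi>_def near_def abs_minus_commute)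
  have "2 * near m + 1 \<noteq> 0" "2 * near m - 1 \<noteq> 0" by presburger+
  hence "of_int (2 * m) * \<alpha> - of_int (2 * near m + 1) \<noteq> 0"
        "of_int (2 * m) * \<alpha> - of_int (2 * near m - 1) \<noteq> 0"
    by (intro int_combination_nonzero irrational; simp)+
  hence "\<xi> m \<noteq> 1 / 2" "\<xi> m \<noteq> - (1 / 2)" by (auto simp: \<xi>_def)
  thus ?thesis using le by linarith
qed

lemma near_unique: "\<bar>of_int m * \<alpha> - of_int n\<bar> < 1 / 2 \<Longrightarrow> near m = n"
  unfolding near_def by (rule round_unique')

lemma \<xi>_inject: "\<xi> m = \<xi> m' \<Longrightarrow> m = m'"
proof (rule ccontr)
  assume eq: "\<xi> m = \<xi> m'" and ne: "m \<noteq> m'"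
  have "of_int (m - m') * \<alpha> - of_int (near m - near m') = 0"
    using eq by (simp add: \<xi>_def algebra_simps)
  thus False using int_combination_nonzero[OF irrational, of "m - m'" "near m - near m'"] ne by simp
qed

lemma \<xi>_nonzero: "m \<noteq> 0 \<Longrightarrow> \<xi> m \<noteq> 0"
  unfolding \<xi>_def by (intro int_combination_nonzero irrational) simp

lemma \<eta>_nonzero: "m \<noteq> 0 \<Longrightarrow> \<eta> m \<noteq> 0"
  unfolding \<eta>_def by (intro int_combination_nonzero beta_irrational) simp

lemma inverse_norm_le:
  assumes "m \<noteq> 0"
  shows "1 / \<bar>\<xi> m * \<eta> m\<bar> \<le> \<bar>of_int a\<bar>"
proof -
  have "1 \<le> \<bar>of_int a\<bar> * \<bar>\<xi> m * \<eta> m\<bar>"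
    using norm_form_ge[of m "near m"] assms by (simp add: \<xi>_def \<eta>_def abs_mult)
  moreover have "0 < \<bar>\<xi> m * \<eta> m\<bar>" using assms \<xi>_nonzero \<eta>_nonzero by simp
  ultimately show ?thesis by (simp add: divide_le_eq)
qed

text \<open>
The weight of the lattice point \<open>(m, near m)\<close>, a constant multiple of the inverse square of its norm;
as such it is invariant under units of norm one.
\<close>
definition W :: "int \<Rightarrow> real" where "W m = 1 / (\<xi> m * \<eta> m)\<^sup>2"

lemma W_nonneg: "0 \<le> W m" by (simp add: W_def)

lemma W_le:
  assumes "m \<noteq> 0"
  shows "W m \<le> (of_int a)\<^sup>2"
proof -
  have "W m = (1 / \<bar>\<xi> m * \<eta> m\<bar>)\<^sup>2" by (simp add: W_def power_divide)
  also have "\<dots> \<le> \<bar>of_int a\<bar>\<^sup>2" using inverse_norm_le[OF assms] by (intro power_mono) auto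
  finally show ?thesis by simp
qed

text \<open>
Cutting off by \<open>\<eta>\<close> instead of \<open>m\<close> makes the scaling under units exact: a cut-off by \<open>m\<close> would leave
an error of order one at every scale.
\<close>
definition slab :: "real \<Rightarrow> int set" where "slab Y = {m. m \<noteq> 0 \<and> \<bar>\<eta> m\<bar> \<le> Y}"

lemma slab_mono: "Y \<le> Z \<Longrightarrow> slab Y \<subseteq> slab Z"
  by (auto simp: slab_def)

lemma finite_slab: "finite (slab Y)"
proof (rule finite_subset)
  show "slab Y \<subseteq> {- \<lceil>(Y + 1) / \<bar>\<delta>\<bar>\<rceil>..\<lceil>(Y + 1) / \<bar>\<delta>\<bar>\<rceil>}"
  proof
    fix m assume "m \<in> slab Y"
    hence "\<bar>of_int m * \<delta>\<bar> \<le> Y + 1"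
      using \<xi>_less_half[of m] unfolding slab_def \<eta>_eq by auto
    hence "\<bar>real_of_int m\<bar> \<le> (Y + 1) / \<bar>\<delta>\<bar>"
      using \<delta>_nonzero by (simp add: abs_mult le_divide_eq)
    thus "m \<in> {- \<lceil>(Y + 1) / \<bar>\<delta>\<bar>\<rceil>..\<lceil>(Y + 1) / \<bar>\<delta>\<bar>\<rceil>}"
      by (auto simp: abs_le_iff) linarith+
  qed
qed simp

text \<open>
As long as the distance to the nearest integer stays below \<open>1 / 4\<close>, doubling \<open>m\<close> doubles it.
\<close>
lemma exists_large_\<xi>:
  assumes "\<kappa> < 1 / 2"
  shows "\<exists>m. m \<noteq> 0 \<and> \<kappa> / 2 \<le> \<bar>\<xi> m\<bar>"
proof (rule ccontr)
  assume "\<not> ?thesis"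
  hence small: "\<bar>\<xi> m\<bar> < 1 / 4" if "m \<noteq> 0" for m using that assms by force
  have double: "\<xi> (2 * m) = 2 * \<xi> m" if "m \<noteq> 0" for m
  proof -
    have eq: "of_int (2 * m) * \<alpha> - of_int (2 * near m) = 2 * \<xi> m" by (simp add: \<xi>_def)
    have "near (2 * m) = 2 * near m"
      by (rule near_unique, unfold eq) (use small[OF that] in \<open>simp add: abs_mult\<close>)
    thus ?thesis using eq by (simp only: \<xi>_def)
  qed
  have pow: "\<xi> (2 ^ k) = 2 ^ k * \<xi> 1" for k :: nat
    by (induction k) (simp_all add: double)
  have "\<xi> 1 \<noteq> 0" by (rule \<xi>_nonzero) simp
  obtain k where "1 / \<bar>\<xi> 1\<bar> < (2 :: real) ^ k" using real_arch_pow[of 2 "1 / \<bar>\<xi> 1\<bar>"] by auto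
  hence "1 < \<bar>\<xi> (2 ^ k)\<bar>"
    using \<open>\<xi> 1 \<noteq> 0\<close> by (simp add: pow abs_mult divide_less_eq)
  thus False using \<xi>_less_half[of "2 ^ k"] by simp
qed

definition V :: "real \<Rightarrow> real" where "V Y = (\<Sum>m\<in>slab Y. W m)"

lemma V_mono: "Y \<le> Z \<Longrightarrow> V Y \<le> V Z"
  unfolding V_def by (intro sum_mono2 finite_slab slab_mono W_nonneg)

lemma V_nonneg: "0 \<le> V Y"
  unfolding V_def by (intro sum_nonneg W_nonneg)

text \<open>
Multiplication by the unit \<open>\<kappa>\<close> on the lattice \<open>\<int> + \<int> \<alpha>\<close>, written in the first coordinate.  It scales \<open>\<xi>\<close>
by \<open>\<kappa>\<close> and \<open>\<eta>\<close> by \<open>1 / \<kappa>\<close>.  A lattice point with \<open>\<bar>\<xi>\<bar> < 1 / 2\<close> is determined by its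
first coordinate, so that the unit acts on integers; the inverse map is multiplication by the conjugate unit.
\<close>
lemma unit_bij_betw:
  assumes unit: "t\<^sup>2 - b * t * u + a * d * u\<^sup>2 = 1"
  defines "\<kappa> \<equiv> of_int t + of_int u * (of_int a * \<alpha>)"
  assumes \<kappa>: "0 < \<kappa>" "\<kappa> < 1 / 2"
  defines "\<tau> \<equiv> (\<lambda>m. (t - u * b) * m - u * a * near m)"
  shows "bij_betw \<tau> (slab Y) {m \<in> slab (Y / \<kappa>). \<bar>\<xi> m\<bar> < \<kappa> / 2}"
    and "m \<noteq> 0 \<Longrightarrow> W (\<tau> m) = W m"
proof -
  define \<kappa>' where "\<kappa>' = of_int t + of_int u * (of_int a * \<beta>)"
  have quad: "of_int a * \<alpha>\<^sup>2 = - of_int b * \<alpha> - of_int d" "of_int a * \<beta>\<^sup>2 = - of_int b * \<beta> - of_int d"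
    using vieta_sum vieta_prod by algebra+
  have kk: "\<kappa> * \<kappa>' = 1"
  proof -
    have "\<kappa> * \<kappa>' = of_int t ^ 2 + of_int t * of_int u * (of_int a * (\<alpha> + \<beta>))
        + of_int a * of_int u ^ 2 * (of_int a * (\<alpha> * \<beta>))"
      unfolding \<kappa>_def \<kappa>'_def by algebra
    also have "\<dots> = of_int (t\<^sup>2 - b * t * u + a * d * u\<^sup>2)"
      unfolding vieta_sum vieta_prod by (simp add: algebra_simps)
    finally show ?thesis using unit by simp
  qed
  have \<kappa>': "\<kappa>' = 1 / \<kappa>" using kk \<kappa> by (simp add: field_simps)
  have act: "of_int ((t - u * b) * m - u * a * n) * x - of_int (u * d * m + t * n)
      = (of_int t + of_int u * (of_int a * x)) * (of_int m * x - of_int n)"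
    if "of_int a * x\<^sup>2 = - of_int b * x - of_int d" for m n and x :: real
  proof -
    have "(of_int t + of_int u * (of_int a * x)) * (of_int m * x - of_int n)
        = of_int t * of_int m * x - of_int t * of_int n - of_int u * of_int a * of_int n * x
          + of_int u * of_int m * (of_int a * x\<^sup>2)"
      by algebra
    thus ?thesis unfolding that by (simp add: algebra_simps)
  qed
  have act': "of_int (t * m + u * a * n) * x - of_int ((t - u * b) * n - u * d * m)
      = (of_int t + of_int u * (- of_int b - of_int a * x)) * (of_int m * x - of_int n)"
    if "of_int a * x\<^sup>2 = - of_int b * x - of_int d" for m n and x :: real
  proof -
    have "(of_int t + of_int u * (- of_int b - of_int a * x)) * (of_int m * x - of_int n)
        = of_int t * of_int m * x - of_int t * of_int n - of_int u * of_int b * of_int m * x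
          + of_int u * of_int b * of_int n + of_int u * of_int a * of_int n * x
          - of_int u * of_int m * (of_int a * x\<^sup>2)"
      by algebra
    thus ?thesis unfolding that by (simp add: algebra_simps)
  qed
  have conj: "- of_int b - of_int a * \<alpha> = of_int a * \<beta>" "- of_int b - of_int a * \<beta> = of_int a * \<alpha>"
    using vieta_sum by (simp_all add: algebra_simps)
  have fwd: "near (\<tau> m) = u * d * m + t * near m \<and> \<xi> (\<tau> m) = \<kappa> * \<xi> m \<and> \<eta> (\<tau> m) = \<eta> m / \<kappa>" for m
  proof -
    have e1: "of_int (\<tau> m) * \<alpha> - of_int (u * d * m + t * near m) = \<kappa> * \<xi> m"
      unfolding \<tau>_def \<kappa>_def \<xi>_def by (rule act[OF quad(1)])
    have e2: "of_int (\<tau> m) * \<beta> - of_int (u * d * m + t * near m) = \<kappa>' * \<eta> m"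
      unfolding \<tau>_def \<kappa>'_def \<eta>_def by (rule act[OF quad(2)])
    have "\<bar>\<kappa> * \<xi> m\<bar> \<le> 1 * \<bar>\<xi> m\<bar>"
      unfolding abs_mult using \<kappa> by (intro mult_right_mono) auto
    hence "near (\<tau> m) = u * d * m + t * near m"
      using \<xi>_less_half[of m] by (intro near_unique, unfold e1) simp
    thus ?thesis using e1 e2 unfolding \<xi>_def[of "\<tau> m"] \<eta>_def[of "\<tau> m"] by (simp add: \<kappa>')
  qed
  have nz: "\<tau> m \<noteq> 0" if "m \<noteq> 0" for m
  proof
    assume "\<tau> m = 0"
    hence "\<kappa> * \<xi> m = \<xi> 0" using fwd[of m] by simp
    also have "\<xi> 0 = 0" by (simp add: \<xi>_def near_def)
    finally show False using \<kappa> \<xi>_nonzero[OF that] by simp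
  qed
  show "W (\<tau> m) = W m" if "m \<noteq> 0"
    using fwd[of m] \<kappa> by (simp add: W_def)
  show "bij_betw \<tau> (slab Y) {m \<in> slab (Y / \<kappa>). \<bar>\<xi> m\<bar> < \<kappa> / 2}"
  proof (rule bij_betw_imageI)
    show "inj_on \<tau> (slab Y)"
    proof (rule inj_onI)
      fix m m' assume "\<tau> m = \<tau> m'"
      moreover have "\<xi> k = \<xi> (\<tau> k) / \<kappa>" for k using fwd[of k] \<kappa> by simp
      ultimately show "m = m'" by (intro \<xi>_inject) metis
    qed
    show "\<tau> ` slab Y = {m \<in> slab (Y / \<kappa>). \<bar>\<xi> m\<bar> < \<kappa> / 2}"
    proof (intro equalityI subsetI)
      fix k assume "k \<in> \<tau> ` slab Y"
      then obtain m where m: "m \<noteq> 0" "\<bar>\<eta> m\<bar> \<le> Y" "k = \<tau> m" by (auto simp: slab_def)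
      have "\<kappa> * \<bar>\<xi> m\<bar> < \<kappa> * (1 / 2)"
        using \<xi>_less_half[of m] \<kappa> by (intro mult_strict_left_mono) auto
      thus "k \<in> {m \<in> slab (Y / \<kappa>). \<bar>\<xi> m\<bar> < \<kappa> / 2}"
        using m fwd[of m] nz[OF m(1)] \<kappa> by (simp add: slab_def abs_mult divide_right_mono)
    next
      fix k assume k: "k \<in> {m \<in> slab (Y / \<kappa>). \<bar>\<xi> m\<bar> < \<kappa> / 2}"
      define m where "m = t * k + u * a * near k"
      define n where "n = (t - u * b) * near k - u * d * k"
      have e1: "of_int m * \<alpha> - of_int n = \<kappa>' * \<xi> k"
        unfolding m_def n_def \<kappa>'_def \<xi>_def conj(1)[symmetric] by (rule act'[OF quad(1)])
      have e2: "of_int m * \<beta> - of_int n = \<kappa> * \<eta> k"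
        unfolding m_def n_def \<kappa>_def \<eta>_def conj(2)[symmetric] by (rule act'[OF quad(2)])
      have "\<bar>\<kappa>' * \<xi> k\<bar> < 1 / 2"
        using k \<kappa> by (simp add: \<kappa>' abs_mult divide_less_eq)
      hence n: "near m = n" by (intro near_unique, unfold e1)
      have "\<xi> m = \<kappa>' * \<xi> k" "\<eta> m = \<kappa> * \<eta> k" using e1 e2 unfolding \<xi>_def[of m] \<eta>_def[of m] n by auto
      moreover have "m \<noteq> 0"
      proof
        assume m0: "m = 0"
        have "\<xi> k \<noteq> 0" using k by (intro \<xi>_nonzero) (auto simp: slab_def)
        hence "\<xi> m \<noteq> 0" using \<open>\<xi> m = \<kappa>' * \<xi> k\<close> \<kappa> by (simp add: \<kappa>')
        thus False using m0 by (simp add: \<xi>_def near_def)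
      qed
      ultimately have "m \<in> slab Y"
        using k \<kappa> by (simp add: slab_def abs_mult field_simps)
      moreover have "\<tau> m = k"
      proof -
        have "\<tau> m = (t - u * b) * m - u * a * n" by (simp add: \<tau>_def n)
        also have "\<dots> = (t\<^sup>2 - b * t * u + a * d * u\<^sup>2) * k"
          unfolding m_def n_def by algebra
        finally show ?thesis using unit by simp
      qed
      ultimately show "k \<in> \<tau> ` slab Y" by blast
    qed
  qed
qed

text \<open>
By \<open>unit_bij_betw\<close>, \<open>V (Y / \<kappa>) - V Y\<close> is the weight \<open>R (Y / \<kappa>)\<close> of the points whose \<open>\<xi>\<close> is bounded away from
zero.  For them \<open>W m\<close> is of order \<open>1 / m\<^sup>2\<close>, so \<open>R\<close> increases to a finite limit \<open>g\<close> with defect \<open>O(1 / Y)\<close>.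
\<close>
lemma V_asymptotics: "\<exists>c>0. \<exists>B. \<forall>Y\<ge>1. \<bar>V Y - c * ln Y\<bar> \<le> B"
proof -
  obtain t u :: int where unit: "t\<^sup>2 - b * t * u + a * d * u\<^sup>2 = 1"
    and small: "0 < of_int t + of_int u * (of_int a * \<alpha>)" "of_int t + of_int u * (of_int a * \<alpha>) < 1 / 2"
    by (rule exists_small_unit)
  define \<kappa> where "\<kappa> = of_int t + of_int u * (of_int a * \<alpha>)"
  have \<kappa>: "0 < \<kappa>" "\<kappa> < 1 / 2" using small by (simp_all add: \<kappa>_def)
  define far where "far Z = {m \<in> slab Z. \<kappa> / 2 \<le> \<bar>\<xi> m\<bar>}" for Z
  define R where "R Z = (\<Sum>m\<in>far Z. W m)" for Z
  have fin: "finite (far Z)" for Z using finite_slab by (simp add: far_def)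
  have rec: "V (Y / \<kappa>) = V Y + R (Y / \<kappa>)" for Y
  proof -
    define \<tau> where "\<tau> = (\<lambda>m. (t - u * b) * m - u * a * near m)"
    have bij: "bij_betw \<tau> (slab Y) {m \<in> slab (Y / \<kappa>). \<bar>\<xi> m\<bar> < \<kappa> / 2}"
      and inv: "\<And>m. m \<noteq> 0 \<Longrightarrow> W (\<tau> m) = W m"
      unfolding \<tau>_def \<kappa>_def using unit_bij_betw[OF unit small] by auto
    have "slab (Y / \<kappa>) = {m \<in> slab (Y / \<kappa>). \<bar>\<xi> m\<bar> < \<kappa> / 2} \<union> far (Y / \<kappa>)"
      by (auto simp: far_def)
    moreover have "{m \<in> slab (Y / \<kappa>). \<bar>\<xi> m\<bar> < \<kappa> / 2} \<inter> far (Y / \<kappa>) = {}"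
      by (auto simp: far_def)
    ultimately have "V (Y / \<kappa>) = (\<Sum>m\<in>{m \<in> slab (Y / \<kappa>). \<bar>\<xi> m\<bar> < \<kappa> / 2}. W m) + R (Y / \<kappa>)"
      unfolding V_def R_def using finite_slab[of "Y / \<kappa>"] fin[of "Y / \<kappa>"]
      by (metis (no_types, lifting) finite_Un sum.union_disjoint)
    also have "(\<Sum>m\<in>{m \<in> slab (Y / \<kappa>). \<bar>\<xi> m\<bar> < \<kappa> / 2}. W m) = (\<Sum>m\<in>slab Y. W (\<tau> m))"
      by (rule sum.reindex_bij_betw[OF bij, symmetric])
    also have "\<dots> = V Y"
      unfolding V_def by (intro sum.cong refl inv) (auto simp: slab_def)
    finally show ?thesis .
  qed
  have R_mono: "R Y \<le> R Z" if "Y \<le> Z" for Y Z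
    unfolding R_def using slab_mono[OF that] by (intro sum_mono2 fin W_nonneg) (auto simp: far_def)
  define K where "K = 4 / \<kappa>\<^sup>2 * (9 / (4 * \<delta>\<^sup>2)) * (4 * (2 * \<bar>\<delta>\<bar>))"
  have K: "0 \<le> K" by (simp add: K_def)
  have R_tail: "R Z - R Y \<le> K / Y" if "1 \<le> Y" "Y \<le> Z" for Y Z
  proof -
    have sub: "far Y \<subseteq> far Z" using slab_mono[OF that(2)] by (auto simp: far_def)
    have D: "m \<noteq> 0 \<and> Y < \<bar>\<eta> m\<bar> \<and> \<kappa> / 2 \<le> \<bar>\<xi> m\<bar>" if "m \<in> far Z - far Y" for m
      using that by (auto simp: far_def slab_def)
    have size: "\<bar>of_int m * \<delta>\<bar> \<le> 3 / 2 * \<bar>\<eta> m\<bar> \<and> Y < 2 * \<bar>of_int m * \<delta>\<bar>" if "m \<in> far Z - far Y" for m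
    proof -
      have "\<bar>of_int m * \<delta>\<bar> \<le> \<bar>\<eta> m\<bar> + \<bar>\<xi> m\<bar>" "\<bar>\<eta> m\<bar> \<le> \<bar>\<xi> m\<bar> + \<bar>of_int m * \<delta>\<bar>"
        unfolding \<eta>_eq by linarith+
      thus ?thesis using D[OF that] \<xi>_less_half[of m] \<open>1 \<le> Y\<close> by (intro conjI; linarith)
    qed
    have "R Z - R Y = (\<Sum>m\<in>far Z - far Y. W m)"
      unfolding R_def using sum_diff[OF fin sub, of W] by simp
    also have "\<dots> \<le> (\<Sum>m\<in>far Z - far Y. 4 / \<kappa>\<^sup>2 * (9 / (4 * \<delta>\<^sup>2)) * (1 / (of_int m)\<^sup>2))"
    proof (intro sum_mono)
      fix m assume m: "m \<in> far Z - far Y"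
      have pos: "0 < \<bar>of_int m * \<delta>\<bar>" using D[OF m] \<delta>_nonzero by simp
      have "\<kappa> / 2 * (2 / 3 * \<bar>of_int m * \<delta>\<bar>) \<le> \<bar>\<xi> m\<bar> * \<bar>\<eta> m\<bar>"
        using D[OF m] size[OF m] \<kappa> by (intro mult_mono) auto
      hence "(\<kappa> / 2 * (2 / 3 * \<bar>of_int m * \<delta>\<bar>))\<^sup>2 \<le> (\<bar>\<xi> m\<bar> * \<bar>\<eta> m\<bar>)\<^sup>2"
        using \<kappa> by (intro power_mono) auto
      hence "W m \<le> 1 / (\<kappa> / 2 * (2 / 3 * \<bar>of_int m * \<delta>\<bar>))\<^sup>2"
        unfolding W_def using pos \<kappa> by (intro frac_le) (auto simp: power_mult_distrib)
      also have "\<dots> = 4 / \<kappa>\<^sup>2 * (9 / (4 * \<delta>\<^sup>2)) * (1 / (of_int m)\<^sup>2)"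
        by (simp add: power_mult_distrib power_divide)
      finally show "W m \<le> 4 / \<kappa>\<^sup>2 * (9 / (4 * \<delta>\<^sup>2)) * (1 / (of_int m)\<^sup>2)" .
    qed
    also have "\<dots> = 4 / \<kappa>\<^sup>2 * (9 / (4 * \<delta>\<^sup>2)) * (\<Sum>m\<in>far Z - far Y. 1 / (of_int m)\<^sup>2)"
      by (simp only: sum_distrib_left)
    also have "\<dots> \<le> 4 / \<kappa>\<^sup>2 * (9 / (4 * \<delta>\<^sup>2)) * (4 / (Y / (2 * \<bar>\<delta>\<bar>)))"
    proof (intro mult_left_mono sum_inverse_squares_tail)
      show "finite (far Z - far Y)" using fin by blast
      show "0 < Y / (2 * \<bar>\<delta>\<bar>)" using that \<delta>_nonzero by simp
      fix m assume "m \<in> far Z - far Y"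
      thus "Y / (2 * \<bar>\<delta>\<bar>) < \<bar>real_of_int m\<bar>"
        using size[of m] \<delta>_nonzero by (simp add: divide_less_eq abs_mult mult_ac)
    qed simp
    also have "\<dots> = K / Y" by (simp add: K_def)
    finally show ?thesis .
  qed
  define g where "g = (SUP Z\<in>{1..}. R Z)"
  have bdd: "bdd_above (R ` {1..})"
  proof (rule bdd_aboveI2)
    fix Z :: real assume "Z \<in> {1..}"
    thus "R Z \<le> R 1 + K / 1" using R_tail[of 1 Z] by simp
  qed
  have g_upper: "R Z \<le> g" if "1 \<le> Z" for Z
    unfolding g_def using that by (intro cSUP_upper bdd) auto
  have g_lower: "g \<le> R Z + K / Z" if "1 \<le> Z" for Z
    unfolding g_def
  proof (rule cSUP_least)
    fix Y :: real assume "Y \<in> {1..}"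
    have "0 \<le> K / Z" using K that by simp
    thus "R Y \<le> R Z + K / Z"
      using R_tail[OF that, of Y] R_mono[of Y Z] by (cases "Y \<le> Z") auto
  qed auto
  have g_pos: "g > 0"
  proof -
    obtain m where m: "m \<noteq> 0" "\<kappa> / 2 \<le> \<bar>\<xi> m\<bar>" using exists_large_\<xi>[OF \<kappa>(2)] by blast
    define Z where "Z = max 1 \<bar>\<eta> m\<bar>"
    have "0 < W m" using m(1) \<xi>_nonzero \<eta>_nonzero by (simp add: W_def)
    also have "W m \<le> R Z"
      unfolding R_def using m by (intro member_le_sum fin W_nonneg) (auto simp: far_def slab_def Z_def)
    also have "\<dots> \<le> g" by (rule g_upper) (simp add: Z_def)
    finally show ?thesis .
  qed
  have "\<exists>B. \<forall>Y\<ge>1. \<bar>V Y - g / ln (1 / \<kappa>) * ln Y\<bar> \<le> B"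
  proof (rule log_growth_of_scaling)
    show "1 / \<kappa> > 1" using \<kappa> by simp
    show "0 \<le> K" by (rule K)
    fix Y :: real assume Y: "1 \<le> Y"
    have Y': "Y \<le> Y / \<kappa>" "1 \<le> Y / \<kappa>" using \<kappa> Y by (simp_all add: field_simps mult_left_le order.trans[of \<kappa> 1 Y])
    have "K / (Y / \<kappa>) \<le> K / Y" using K Y Y' by (intro frac_le) auto
    hence "\<bar>R (Y / \<kappa>) - g\<bar> \<le> K / Y"
      using g_upper[OF Y'(2)] g_lower[OF Y'(2)] by linarith
    thus "\<bar>V (1 / \<kappa> * Y) - V Y - g\<bar> \<le> K / Y" using rec[of Y] by simp
  next
    fix Y :: real assume "1 \<le> Y" "Y \<le> 1 / \<kappa>"
    thus "\<bar>V Y\<bar> \<le> V (1 / \<kappa>)" using V_mono[of Y "1 / \<kappa>"] V_nonneg[of Y] by simp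
  qed
  moreover have "g / ln (1 / \<kappa>) > 0" using g_pos \<kappa> by simp
  ultimately show ?thesis by blast
qed

text \<open>
Two replacements: \<open>sin\<^sup>2 (\<pi> \<xi>)\<close> by \<open>(\<pi> \<xi>)\<^sup>2\<close>, and \<open>(m \<delta>)\<^sup>2 = (\<xi> - \<eta>)\<^sup>2\<close> by \<open>\<eta>\<^sup>2\<close>.  Each costs
\<open>O(1 / m\<^sup>2)\<close>, the second because \<open>\<bar>\<xi> \<eta>\<bar>\<close> is bounded below.
\<close>
lemma diagonal_term_approx:
  assumes "m \<noteq> 0"
  shows "\<bar>1 / ((of_int m)\<^sup>2 * (sin (pi * of_int m * \<alpha>))\<^sup>2) - \<delta>\<^sup>2 / pi\<^sup>2 * W m\<bar>
    \<le> (3 + 2 * \<bar>of_int a\<bar> + (of_int a)\<^sup>2) * (1 / (of_int m)\<^sup>2)"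
proof -
  have nz: "\<xi> m \<noteq> 0" "\<eta> m \<noteq> 0" using assms by (simp_all add: \<xi>_nonzero \<eta>_nonzero)
  define M where "M = (real_of_int m)\<^sup>2"
  have M: "0 < M" using assms by (simp add: M_def)
  have sin_eq: "(sin (pi * of_int m * \<alpha>))\<^sup>2 = (sin (pi * \<xi> m))\<^sup>2"
  proof -
    have "\<bar>sin (pi * of_int m * \<alpha>)\<bar> = \<bar>sin (pi * \<xi> m)\<bar>"
      unfolding \<xi>_def abs_sin_pi_shift by (simp only: mult.assoc)
    thus ?thesis by (metis power2_abs)
  qed
  have "pi * \<bar>\<xi> m\<bar> \<le> pi * (1 / 2)"
    using \<xi>_less_half[of m] by (intro mult_left_mono) auto
  hence A: "\<bar>1 / (sin (pi * \<xi> m))\<^sup>2 - 1 / (pi * \<xi> m)\<^sup>2\<bar> \<le> 3"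
    using nz by (intro inverse_sin_squared_bound) (auto simp: abs_mult)
  have md: "(of_int m * \<delta>)\<^sup>2 = (\<xi> m - \<eta> m)\<^sup>2" by (simp add: \<eta>_eq)
  have "1 / (\<xi> m)\<^sup>2 - (of_int m * \<delta>)\<^sup>2 * W m = 2 / (\<xi> m * \<eta> m) - 1 / (\<eta> m)\<^sup>2"
    unfolding md W_def using nz by (simp add: field_simps power2_eq_square)
  moreover have "\<bar>2 / (\<xi> m * \<eta> m)\<bar> \<le> 2 * \<bar>of_int a\<bar>"
    using inverse_norm_le[OF assms] by simp
  moreover have "1 / (\<eta> m)\<^sup>2 \<le> (of_int a)\<^sup>2"
  proof -
    have "1 / (\<eta> m)\<^sup>2 = (\<xi> m)\<^sup>2 * W m" using nz by (simp add: W_def power_mult_distrib)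
    also have "\<dots> \<le> 1 * W m"
      using \<xi>_less_half[of m] by (intro mult_right_mono W_nonneg) (simp add: abs_square_le_1)
    also have "\<dots> \<le> (of_int a)\<^sup>2" using W_le[OF assms] by simp
    finally show ?thesis .
  qed
  moreover have "0 \<le> 1 / (\<eta> m)\<^sup>2" by simp
  ultimately have B: "\<bar>1 / (\<xi> m)\<^sup>2 - (of_int m * \<delta>)\<^sup>2 * W m\<bar> \<le> 2 * \<bar>of_int a\<bar> + (of_int a)\<^sup>2"
    by linarith
  have "1 \<le> pi\<^sup>2" using pi_gt3 by (intro one_le_power) auto
  hence "\<bar>1 / (\<xi> m)\<^sup>2 - (of_int m * \<delta>)\<^sup>2 * W m\<bar> / pi\<^sup>2 \<le> \<bar>1 / (\<xi> m)\<^sup>2 - (of_int m * \<delta>)\<^sup>2 * W m\<bar> / 1"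
    by (intro divide_left_mono) auto
  hence B': "\<bar>(1 / (\<xi> m)\<^sup>2 - (of_int m * \<delta>)\<^sup>2 * W m) / pi\<^sup>2\<bar> \<le> 2 * \<bar>of_int a\<bar> + (of_int a)\<^sup>2"
    using B by simp
  have "1 / (M * (sin (pi * of_int m * \<alpha>))\<^sup>2) - \<delta>\<^sup>2 / pi\<^sup>2 * W m
      = ((1 / (sin (pi * \<xi> m))\<^sup>2 - 1 / (pi * \<xi> m)\<^sup>2)
         + (1 / (\<xi> m)\<^sup>2 - (of_int m * \<delta>)\<^sup>2 * W m) / pi\<^sup>2) * (1 / M)"
  proof -
    have "(1 / (\<xi> m)\<^sup>2 - (of_int m * \<delta>)\<^sup>2 * W m) / pi\<^sup>2 = 1 / (pi * \<xi> m)\<^sup>2 - M * (\<delta>\<^sup>2 / pi\<^sup>2 * W m)"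
      by (simp add: M_def power_mult_distrib diff_divide_distrib mult_ac)
    thus ?thesis unfolding sin_eq using M by (simp add: left_diff_distrib diff_divide_distrib)
  qed
  also have "\<bar>\<dots>\<bar> = \<bar>(1 / (sin (pi * \<xi> m))\<^sup>2 - 1 / (pi * \<xi> m)\<^sup>2)
         + (1 / (\<xi> m)\<^sup>2 - (of_int m * \<delta>)\<^sup>2 * W m) / pi\<^sup>2\<bar> * (1 / M)"
    using M by (simp only: abs_mult) simp
  also have "\<dots> \<le> (3 + 2 * \<bar>of_int a\<bar> + (of_int a)\<^sup>2) * (1 / M)"
  proof (rule mult_right_mono)
    show "\<bar>(1 / (sin (pi * \<xi> m))\<^sup>2 - 1 / (pi * \<xi> m)\<^sup>2)
         + (1 / (\<xi> m)\<^sup>2 - (of_int m * \<delta>)\<^sup>2 * W m) / pi\<^sup>2\<bar> \<le> 3 + 2 * \<bar>of_int a\<bar> + (of_int a)\<^sup>2"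
      using A B' by linarith
  qed (use M in simp)
  finally show ?thesis unfolding M_def .
qed

text \<open>
It remains to pass from the range \<open>\<bar>m\<bar> \<le> X\<close> to \<open>\<bar>\<eta> m\<bar> \<le> \<bar>\<delta>\<bar> X\<close>.  As \<open>\<bar>\<eta> m\<bar>\<close> and \<open>\<bar>m \<delta>\<bar>\<close> differ by at most
\<open>1 / 2\<close>, the two ranges differ by a bounded number of integers, all of bounded weight.  Both signs of \<open>m\<close> are
used because units need not preserve the sign; this doubles the sum.
\<close>
lemma diagonal_asymptotics:
  "\<exists>c>0. \<exists>B. \<forall>X\<ge>1. \<bar>(\<Sum>m=1..X. 1 / ((real m)\<^sup>2 * (sin (pi * real m * \<alpha>))\<^sup>2)) - c * ln (real X)\<bar> \<le> B"
proof -
  obtain c B where c: "c > 0" and B: "\<And>Y. Y \<ge> 1 \<Longrightarrow> \<bar>V Y - c * ln Y\<bar> \<le> B"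
    using V_asymptotics by blast
  define D where "D = \<bar>\<delta>\<bar>"
  have D: "0 < D" using \<delta>_nonzero by (simp add: D_def)
  define q where "q = \<delta>\<^sup>2 / pi\<^sup>2"
  have q: "0 < q" using \<delta>_nonzero by (simp add: q_def)
  define A where "A = (real_of_int a)\<^sup>2"
  define K where "K = 3 + 2 * \<bar>real_of_int a\<bar> + A"
  define H where "H = \<lceil>1 / D\<rceil>"
  have H: "1 / D \<le> of_int H" "0 \<le> H"
  proof -
    show le: "1 / D \<le> of_int H" by (simp add: H_def)
    have "0 \<le> 1 / D" using D by simp
    thus "0 \<le> H" using le by linarith
  qed
  define F where "F m = 1 / ((real_of_int m)\<^sup>2 * (sin (pi * of_int m * \<alpha>))\<^sup>2)" for m
  define J where "J X = {m :: int. m \<noteq> 0 \<and> \<bar>m\<bar> \<le> int X}" for X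
  have finJ: "finite (J X)" for X
    by (rule finite_subset[of _ "{- int X..int X}"]) (auto simp: J_def)
  have J_sum: "(\<Sum>m\<in>J X. F m) = 2 * (\<Sum>m=1..X. 1 / ((real m)\<^sup>2 * (sin (pi * real m * \<alpha>))\<^sup>2))" for X
  proof -
    have "J X = int ` {1..X} \<union> (\<lambda>n. - int n) ` {1..X}"
    proof (intro equalityI subsetI)
      fix m assume "m \<in> J X"
      hence "m = int (nat \<bar>m\<bar>) \<or> m = - int (nat \<bar>m\<bar>)" "nat \<bar>m\<bar> \<in> {1..X}"
        by (auto simp: J_def)
      thus "m \<in> int ` {1..X} \<union> (\<lambda>n. - int n) ` {1..X}" by blast
    qed (auto simp: J_def)
    moreover have "int ` {1..X} \<inter> (\<lambda>n. - int n) ` {1..X} = {}" by auto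
    ultimately have "(\<Sum>m\<in>J X. F m) = (\<Sum>m\<in>int ` {1..X}. F m) + (\<Sum>m\<in>(\<lambda>n. - int n) ` {1..X}. F m)"
      by (simp only: sum.union_disjoint finite_imageI finite_atLeastAtMost)
    also have "\<dots> = (\<Sum>n=1..X. F (int n)) + (\<Sum>n=1..X. F (- int n))"
      by (subst (1 2) sum.reindex) (auto simp: inj_on_def)
    also have "(\<Sum>n=1..X. F (- int n)) = (\<Sum>n=1..X. F (int n))" by (simp add: F_def)
    finally show ?thesis by (simp add: F_def)
  qed
  have F_W: "\<bar>(\<Sum>m\<in>J X. F m) - q * (\<Sum>m\<in>J X. W m)\<bar> \<le> K * 8" for X
  proof -
    have "(\<Sum>m\<in>J X. F m) - q * (\<Sum>m\<in>J X. W m) = (\<Sum>m\<in>J X. F m - q * W m)"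
      by (simp only: sum_subtractf sum_distrib_left)
    also have "\<bar>\<dots>\<bar> \<le> (\<Sum>m\<in>J X. K * (1 / (of_int m)\<^sup>2))"
    proof (rule order.trans[OF sum_abs], rule sum_mono)
      fix m assume "m \<in> J X"
      thus "\<bar>F m - q * W m\<bar> \<le> K * (1 / (of_int m)\<^sup>2)"
        unfolding F_def q_def K_def A_def by (intro diagonal_term_approx) (auto simp: J_def)
    qed
    also have "\<dots> = K * (\<Sum>m\<in>J X. 1 / (of_int m)\<^sup>2)" by (simp only: sum_distrib_left)
    also have "\<dots> \<le> K * (4 / (1 / 2))"
    proof (intro mult_left_mono sum_inverse_squares_tail finJ)
      fix m assume "m \<in> J X"
      hence "1 \<le> \<bar>m\<bar>" by (auto simp: J_def)
      thus "1 / 2 < \<bar>real_of_int m\<bar>" by linarith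
    qed (auto simp: K_def A_def)
    finally show ?thesis by simp
  qed
  define card_bound where "card_bound = real (card {- 2 * H..2 * H}) * 2"
  have W_V: "\<bar>(\<Sum>m\<in>J X. W m) - V (D * real X)\<bar> \<le> card_bound * A" for X
  proof -
    define S where "S = {int X - H..int X + H} \<union> {- int X - H..- int X + H}"
    have finS: "finite S" by (simp add: S_def)
    have near_eta: "\<bar>\<bar>\<eta> m\<bar> - \<bar>of_int m\<bar> * D\<bar> \<le> 1 / 2" for m
    proof -
      have "\<bar>of_int m * \<delta>\<bar> = \<bar>of_int m\<bar> * D" by (simp add: D_def abs_mult)
      thus ?thesis using \<xi>_less_half[of m] unfolding \<eta>_eq by linarith
    qed
    have inS: "m \<in> S" if "\<bar>\<bar>of_int m\<bar> - real X\<bar> * D \<le> 1 / 2" for m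
    proof -
      have "\<bar>\<bar>of_int m\<bar> - real X\<bar> \<le> (1 / 2) / D" using that D by (simp add: le_divide_eq)
      also have "\<dots> \<le> of_int H" using H D by (simp add: field_simps)
      finally have "\<bar>\<bar>m\<bar> - int X\<bar> \<le> H" by linarith
      thus ?thesis by (auto simp: S_def)
    qed
    have sub1: "J X - slab (D * real X) \<subseteq> S - {0}"
    proof
      fix m assume m: "m \<in> J X - slab (D * real X)"
      hence "\<bar>of_int m\<bar> \<le> real X" "D * real X < \<bar>\<eta> m\<bar>" "m \<noteq> 0"
        by (auto simp: J_def slab_def)
      moreover from this have "(real X - \<bar>of_int m\<bar>) * D \<le> 1 / 2"
        using near_eta[of m] unfolding left_diff_distrib mult.commute[of D] by linarith
      ultimately show "m \<in> S - {0}" using inS[of m] by simp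
    qed
    have sub2: "slab (D * real X) - J X \<subseteq> S - {0}"
    proof
      fix m assume m: "m \<in> slab (D * real X) - J X"
      hence "real X \<le> \<bar>of_int m\<bar>" "\<bar>\<eta> m\<bar> \<le> D * real X" "m \<noteq> 0"
        by (auto simp: J_def slab_def)
      moreover from this have "(\<bar>of_int m\<bar> - real X) * D \<le> 1 / 2"
        using near_eta[of m] unfolding left_diff_distrib mult.commute[of D] by linarith
      ultimately show "m \<in> S - {0}" using inS[of m] by simp
    qed
    have small: "0 \<le> (\<Sum>m\<in>E. W m) \<and> (\<Sum>m\<in>E. W m) \<le> card_bound * A" if E: "E \<subseteq> S - {0}" for E
    proof
      show "0 \<le> (\<Sum>m\<in>E. W m)" by (intro sum_nonneg W_nonneg)
      have "(\<Sum>m\<in>E. W m) \<le> (\<Sum>m\<in>E. A)"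
        using E by (intro sum_mono) (auto simp: A_def intro!: W_le)
      also have "\<dots> = real (card E) * A" by simp
      also have "\<dots> \<le> card_bound * A"
      proof (rule mult_right_mono)
        have "card E \<le> card S" using E finS by (intro card_mono) auto
        also have "\<dots> \<le> card {int X - H..int X + H} + card {- int X - H..- int X + H}"
          unfolding S_def by (rule card_Un_le)
        also have "\<dots> \<le> 2 * card {- 2 * H..2 * H}" using H by simp
        finally show "real (card E) \<le> card_bound" unfolding card_bound_def by linarith
      qed (simp add: A_def)
      finally show "(\<Sum>m\<in>E. W m) \<le> card_bound * A" .
    qed
    have "(\<Sum>m\<in>J X. W m) = (\<Sum>m\<in>J X \<inter> slab (D * real X). W m) + (\<Sum>m\<in>J X - slab (D * real X). W m)"
      by (rule sum.Int_Diff[OF finJ])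
    moreover have "V (D * real X) = (\<Sum>m\<in>slab (D * real X) \<inter> J X. W m) + (\<Sum>m\<in>slab (D * real X) - J X. W m)"
      unfolding V_def by (rule sum.Int_Diff[OF finite_slab])
    moreover have "slab (D * real X) \<inter> J X = J X \<inter> slab (D * real X)" by (rule Int_commute)
    ultimately show ?thesis using small[OF sub1] small[OF sub2] by (simp only:) linarith
  qed
  define B2 where "B2 = \<bar>B\<bar> + V 1 + c * \<bar>ln D\<bar>"
  have V_ln: "\<bar>V (D * real X) - c * ln (real X)\<bar> \<le> B2" if X: "X \<ge> 1" for X
  proof -
    have "ln (D * real X) = ln D + ln (real X)" using D X by (intro ln_mult_pos) auto
    hence cl: "c * ln (D * real X) = c * ln D + c * ln (real X)" by (simp only: distrib_left)
    have cD: "\<bar>c * ln D\<bar> = c * \<bar>ln D\<bar>" using c by (simp add: abs_mult)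
    show ?thesis
    proof (cases "D * real X \<ge> 1")
      case True
      thus ?thesis using B[OF True] cl cD V_nonneg[of 1] unfolding B2_def by linarith
    next
      case False
      have "0 \<le> c * ln (real X)" using X c by simp
      moreover have "c * ln (D * real X) \<le> 0"
      proof (rule mult_nonneg_nonpos)
        have "0 < D * real X" using D X by simp
        thus "ln (D * real X) \<le> 0" using False by simp
      qed (use c in simp)
      ultimately show ?thesis
        using V_mono[of "D * real X" 1] V_nonneg[of "D * real X"] False cl cD unfolding B2_def by linarith
    qed
  qed
  show ?thesis
  proof (rule exI[of _ "q * c / 2"], rule conjI, use q c in simp,
      rule exI[of _ "(K * 8 + q * (card_bound * A + B2)) / 2"], intro allI impI)
    fix X :: nat assume X: "X \<ge> 1"
    have "\<bar>(\<Sum>m\<in>J X. W m) - c * ln (real X)\<bar> \<le> card_bound * A + B2"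
      using W_V[of X] V_ln[OF X] by linarith
    hence "q * \<bar>(\<Sum>m\<in>J X. W m) - c * ln (real X)\<bar> \<le> q * (card_bound * A + B2)"
      using q by (intro mult_left_mono) auto
    moreover have "q * \<bar>(\<Sum>m\<in>J X. W m) - c * ln (real X)\<bar> = \<bar>q * (\<Sum>m\<in>J X. W m) - q * c * ln (real X)\<bar>"
      using q by (simp add: abs_mult mult.assoc flip: right_diff_distrib)
    ultimately have bound: "\<bar>(\<Sum>m\<in>J X. F m) - q * c * ln (real X)\<bar> \<le> K * 8 + q * (card_bound * A + B2)"
      using F_W[of X] by linarith
    thus "\<bar>(\<Sum>m=1..X. 1 / ((real m)\<^sup>2 * (sin (pi * real m * \<alpha>))\<^sup>2)) - q * c / 2 * ln (real X)\<bar>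
       \<le> (K * 8 + q * (card_bound * A + B2)) / 2"
    proof -
      have "q * c / 2 * ln (real X) = (q * c * ln (real X)) / 2" by simp
      moreover have "\<bar>S - x\<bar> \<le> E / 2" if "\<bar>2 * S - y\<bar> \<le> E" "x = y / 2" for S x y E :: real
        using that by linarith
      ultimately show ?thesis using bound unfolding J_sum by blast
    qed
  qed
qed

end

lemma quadratic_irrational_conjugate_pair:
  assumes "quadratic_irrational \<alpha>"
  obtains \<beta> a b d where "conjugate_pair \<alpha> \<beta> a b d"
proof -
  obtain p :: "int poly" where irr: "\<alpha> \<notin> \<rat>" and p: "degree p = 2" "poly (map_poly real_of_int p) \<alpha> = 0"
    using assms unfolding quadratic_irrational_def by blast
  define a b d where "a = coeff p 2" and "b = coeff p 1" and "d = coeff p 0"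
  have a0: "a \<noteq> 0" using p(1) unfolding a_def by (metis degree_0 leading_coeff_neq_0 zero_neq_numeral)
  have "poly (map_poly real_of_int p) \<alpha> = (\<Sum>i\<le>2. coeff (map_poly real_of_int p) i * \<alpha> ^ i)"
    using p(1) by (subst poly_altdef) (simp add: degree_map_poly)
  also have "\<dots> = of_int d + of_int b * \<alpha> + of_int a * \<alpha>\<^sup>2"
    by (simp add: eval_nat_numeral coeff_map_poly a_def b_def d_def)
  finally have root: "of_int d + of_int b * \<alpha> + of_int a * \<alpha>\<^sup>2 = 0" using p(2) by simp
  define \<beta> where "\<beta> = - of_int b / of_int a - \<alpha>"
  have "conjugate_pair \<alpha> \<beta> a b d"
  proof
    show "of_int a * (\<alpha> + \<beta>) = - of_int b" using a0 by (simp add: \<beta>_def)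
    hence "of_int a * \<beta> = - of_int b - of_int a * \<alpha>" by (simp add: distrib_left)
    hence "\<alpha> * (of_int a * \<beta>) = \<alpha> * (- of_int b - of_int a * \<alpha>)" by simp
    thus "of_int a * (\<alpha> * \<beta>) = of_int d" using root by (simp add: algebra_simps power2_eq_square)
  qed (use irr a0 in auto)
  thus thesis by (rule that)
qed

section \<open>The theorem\<close>

theorem mainTheorem3:
  fixes \<alpha> :: real
  assumes "quadratic_irrational \<alpha>"
  shows "\<exists>\<sigma>>0. \<exists>C::real. \<forall>M::nat. M \<ge> 3 \<longrightarrow>
    \<bar>1 / real M * (\<Sum>N=1..M. (ln (sudler_product N \<alpha>) - 1 / 2 * ln (real M))^2)
       - \<sigma>^2 * ln (real M)\<bar>
    \<le> C * (ln (ln (real M)))^4"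
proof -
  obtain \<beta> a b d where "conjugate_pair \<alpha> \<beta> a b d"
    using quadratic_irrational_conjugate_pair[OF assms] .
  then interpret conjugate_pair \<alpha> \<beta> a b d .
  interpret badly_approximable \<alpha> "1 / (of_int \<bar>a\<bar> * (1 + \<bar>\<delta>\<bar>))" by (rule badly_approximable)
  obtain c B where c: "c > 0" and B: "\<And>X. X \<ge> 1 \<Longrightarrow>
      \<bar>(\<Sum>m=1..X. 1 / ((real m)\<^sup>2 * (sin (pi * real m * \<alpha>))\<^sup>2)) - c * ln (real X)\<bar> \<le> B"
    using diagonal_asymptotics by blast
  obtain C where C: "\<And>M. M \<ge> 2 \<Longrightarrow> \<bar>1 / real M * (\<Sum>N=1..M. (ln (sudler_product N \<alpha>) - 1 / 2 * ln (real M))\<^sup>2)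
     - 1 / 8 * (\<Sum>m=1..M. 1 / ((real m)\<^sup>2 * (s m)\<^sup>2))\<bar> \<le> C"
    using sudler_variance by blast
  define \<sigma> where "\<sigma> = sqrt (c / 8)"
  have \<sigma>: "\<sigma> > 0" "\<sigma>\<^sup>2 = c / 8" using c by (simp_all add: \<sigma>_def)
  have ln3: "1 < ln (3 :: real)" using ln3_gt_1 .
  define L where "L = (ln (ln 3 :: real)) ^ 4"
  have L: "0 < L" using ln3 unfolding L_def by (intro zero_less_power) simp
  have bound: "\<bar>1 / real M * (\<Sum>N=1..M. (ln (sudler_product N \<alpha>) - 1 / 2 * ln (real M))^2)
       - \<sigma>^2 * ln (real M)\<bar> \<le> (\<bar>C\<bar> + \<bar>B\<bar>) / L * (ln (ln (real M)))^4" if M: "M \<ge> 3" for M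
  proof -
    have s2: "(s m)\<^sup>2 = (sin (pi * real m * \<alpha>))\<^sup>2" for m by (simp add: s_def)
    have "\<bar>(\<Sum>m=1..M. 1 / ((real m)\<^sup>2 * (s m)\<^sup>2)) - c * ln (real M)\<bar> \<le> B"
      unfolding s2 using B[of M] M by simp
    hence "\<bar>1 / real M * (\<Sum>N=1..M. (ln (sudler_product N \<alpha>) - 1 / 2 * ln (real M))^2)
       - \<sigma>^2 * ln (real M)\<bar> \<le> \<bar>C\<bar> + \<bar>B\<bar>"
      using C[of M] M unfolding \<sigma>(2) by linarith
    also have "\<dots> = (\<bar>C\<bar> + \<bar>B\<bar>) / L * L" using L by simp
    also have "L \<le> (ln (ln (real M))) ^ 4"
    proof -
      have "ln 3 \<le> ln (real M)" using M by simp
      thus ?thesis unfolding L_def using ln3 by (intro power_mono) auto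
    qed
    hence "(\<bar>C\<bar> + \<bar>B\<bar>) / L * L \<le> (\<bar>C\<bar> + \<bar>B\<bar>) / L * (ln (ln (real M))) ^ 4"
      using L by (intro mult_left_mono) auto
    finally show ?thesis .
  qed
  show ?thesis using \<sigma>(1) bound by blast
qed

end
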